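(* The component twin-width of $A_3^h$ is $\Omega(h/\log h)$, i.e., there is an absolute constant $c>0$ such that $\mathrm{ctww}(A_3^h)\geq c\,h/\log h$ for all sufficiently large $h$.
   Context: Let $T$ be the complete ternary tree of depth $h$. The level of a node is $h$ minus its depth (leaves have level $0$). At each level $l$, the nodes are numbered $a_l^1,a_l^2,\dots$ from left to right. Two nodes $a_l^i,a_l^j$ at the same level $l$ are $l$-linked if $|j-i|=3$. The graph $A_3^h$ has as vertex set the $3^h$ leaves of $T$, and two leaves $u,v$ are adjacent iff there is a level $l$ and (non-strict) ancestors $a_l^i$ of $u$ and $a_l^j$ of $v$ that are $l$-linked. A partition sequence of an $n$-vertex graph $G$ is a sequence $\mathcal P_n,\dots,\mathcal P_1$ of partitions of $V(G)$ with $\mathcal P_n$ the singleton partition, $\mathcal P_1=\{V(G)\}$, each $\mathcal P_i$ obtained from $\mathcal P_{i+1}$ by merging two parts. Distinct parts $X,Y$ are inhomogeneous if there are $u,u'\in X$, $v,v'\in Y$ with $uv\in E(G)$, $u'v'\notin E(G)$; the red graph $\mathcal R(\mathcal P)$ has vertex set $\mathcal P$ and edges between inhomogeneous parts. The component twin-width $\mathrm{ctww}(G)$ is the minimum over partition sequences of the maximum, over $i$, of the number of vertices of a largest connected component of $\mathcal R(\mathcal P_i)$. *)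

theory Defs
  imports Complex_Main "HOL-Library.Disjoint_Sets"
begin

type_synonym 'a graph = "'a set \<times> 'a set set"

abbreviation verts :: "'a graph \<Rightarrow> 'a set" where
  "verts G \<equiv> fst G"

abbreviation edges :: "'a graph \<Rightarrow> 'a set set" where
  "edges G \<equiv> snd G"

definition adj_rel :: "'a graph \<Rightarrow> ('a \<times> 'a) set" where
  "adj_rel G = {(u, v). u \<in> verts G \<and> v \<in> verts G \<and> {u, v} \<in> edges G}"

definition components :: "'a graph \<Rightarrow> 'a set set" where
  "components G = (\<lambda>v. {w \<in> verts G. (v, w) \<in> (adj_rel G)\<^sup>*}) ` verts G"

definition largest_component :: "'a graph \<Rightarrow> nat" where
  "largest_component G = Max (card ` components G)"


definition inhomogeneous :: "'a graph \<Rightarrow> 'a set \<Rightarrow> 'a set \<Rightarrow> bool" where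
  "inhomogeneous G X Y \<longleftrightarrow>
     (\<exists>u\<in>X. \<exists>v\<in>Y. {u, v} \<in> edges G) \<and> (\<exists>u'\<in>X. \<exists>v'\<in>Y. {u', v'} \<notin> edges G)"

definition red_graph :: "'a graph \<Rightarrow> 'a set set \<Rightarrow> 'a set graph" where
  "red_graph G P = (P, {{X, Y} | X Y. X \<in> P \<and> Y \<in> P \<and> X \<noteq> Y \<and> inhomogeneous G X Y})"

text \<open>Only the values of a partition sequence at the indices from 1 to the number of
  vertices are meaningful; the index is the number of parts.\<close>

definition partition_sequence :: "'a graph \<Rightarrow> (nat \<Rightarrow> 'a set set) \<Rightarrow> bool" where
  "partition_sequence G \<P> \<longleftrightarrow>
     (\<forall>i\<in>{1..card (verts G)}. partition_on (verts G) (\<P> i)) \<and>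
     \<P> (card (verts G)) = (\<lambda>v. {v}) ` verts G \<and>
     \<P> 1 = {verts G} \<and>
     (\<forall>i\<in>{1..<card (verts G)}. \<exists>X\<in>\<P> (Suc i). \<exists>Y\<in>\<P> (Suc i).
        X \<noteq> Y \<and> \<P> i = insert (X \<union> Y) (\<P> (Suc i) - {X, Y}))"

text \<open>Every finite graph with at least one vertex has a partition sequence, so for such
  graphs the infimum of natural numbers below is an attained minimum.\<close>

definition ctww :: "'a graph \<Rightarrow> nat" where
  "ctww G = (INF \<P> \<in> {\<P>. partition_sequence G \<P>}.
     MAX i \<in> {1..card (verts G)}. largest_component (red_graph G (\<P> i)))"


text \<open>A node of the complete ternary tree of depth \<open>h\<close> is the pair \<open>(l, i)\<close> of its level
  and its position, counted from 1 and from left to right, among the \<open>3 ^ (h - l)\<close> nodes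
  of that level. The children of the \<open>i\<close>-th node of a level are then, from left to right,
  the nodes at positions \<open>3 * i - 2\<close>, \<open>3 * i - 1\<close>, \<open>3 * i\<close> one level below.\<close>

definition tree_nodes :: "nat \<Rightarrow> (nat \<times> nat) set" where
  "tree_nodes h = {(l, i). l \<le> h \<and> 1 \<le> i \<and> i \<le> 3 ^ (h - l)}"

definition tree_child :: "nat \<Rightarrow> ((nat \<times> nat) \<times> (nat \<times> nat)) set" where
  "tree_child h = {((Suc l, i), (l, j)) | l i j.
     (Suc l, i) \<in> tree_nodes h \<and> j \<in> {3 * i - 2, 3 * i - 1, 3 * i}}"

definition tree_leaves :: "nat \<Rightarrow> (nat \<times> nat) set" where
  "tree_leaves h = {x \<in> tree_nodes h. fst x = 0}"

definition tree_ancestor :: "nat \<Rightarrow> nat \<times> nat \<Rightarrow> nat \<times> nat \<Rightarrow> bool" where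
  "tree_ancestor h a x \<longleftrightarrow> (a, x) \<in> (tree_child h)\<^sup>*"

definition linked :: "nat \<Rightarrow> nat \<times> nat \<Rightarrow> nat \<times> nat \<Rightarrow> bool" where
  "linked l a b \<longleftrightarrow> fst a = l \<and> fst b = l \<and> \<bar>int (snd b) - int (snd a)\<bar> = 3"

definition A3 :: "nat \<Rightarrow> (nat \<times> nat) graph" where
  "A3 h = (tree_leaves h,
     {{u, v} | u v. u \<in> tree_leaves h \<and> v \<in> tree_leaves h \<and>
        (\<exists>l. \<exists>a\<in>tree_nodes h. \<exists>b\<in>tree_nodes h.
           tree_ancestor h a u \<and> tree_ancestor h b v \<and> linked l a b)})"

end

theory Submission
  imports Defs
begin

text \<open>The argument gives the linear bound \<open>h \<le> 18 * ctww (A3 h) + 38\<close>. Stop a partition sequence of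
  component width \<open>k\<close> just before some red component becomes large. A union \<open>U\<close> of at most
  \<open>k + 1\<close> parts then contains between one and two thirds of the middle third of the leaves, and
  its vertices have at most \<open>k + 1\<close> different neighbourhoods in the complement \<open>W\<close>.

  By a discrete intermediate value argument there is a position \<open>p\<close> around which both \<open>U\<close> and \<open>W\<close>
  are dense at every scale \<open>3 ^ t\<close>. If every neighbourhood type occurring in \<open>U\<close> within distance
  \<open>3 ^ (m + 20)\<close> of \<open>p\<close> already occurred within distance \<open>3 ^ (m + 2)\<close>, then at the intermediate
  levels every such vertex of \<open>U\<close> would see \<open>W\<close> like one of the at most two tree nodes containing
  \<open>p\<close>; propagating this along the links fills whole blocks around \<open>p\<close> with vertices of
  \<open>U\<close> and contradicts the density of \<open>W\<close>. Hence a new type appears every 18 levels.\<close>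

subsection \<open>Linked positions\<close>

text \<open>Positions are counted from 0, and \<open>x div 3 ^ l\<close> is the tree node (block) of
  level \<open>l\<close> above \<open>x\<close>. Admitting all integers and all levels makes the
  relation invariant under the reflection \<open>- 1 - x\<close>. Levels above the height add no
  links between leaves, which then all share block 0.\<close>

definition leaf_link :: "int \<Rightarrow> int \<Rightarrow> bool" where
  "leaf_link x y \<longleftrightarrow> (\<exists>l::nat. \<bar>x div 3 ^ l - y div 3 ^ l\<bar> = 3)"

lemma abs_div_diff_le:
  fixes x y d n :: int
  assumes "\<bar>x - y\<bar> \<le> n * d" "d > 0"
  shows "\<bar>x div d - y div d\<bar> \<le> n"
proof -
  have "x div d \<le> (y + n * d) div d" "y div d \<le> (x + n * d) div d"
    by (rule zdiv_mono1; use assms in linarith)+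
  then show ?thesis using assms(2) by auto
qed

lemma div_power3_add: "(x::int) div 3 ^ (t + k) = x div 3 ^ t div 3 ^ k"
  by (simp add: power_add zdiv_zmult2_eq)

lemma div_power3_Suc: "(x::int) div 3 ^ Suc t = x div 3 ^ t div 3"
  using div_power3_add[of x t 1] by simp

lemma leaf_linkI: "\<bar>x div 3 ^ t - y div 3 ^ t\<bar> = 3 \<Longrightarrow> leaf_link x y"
  by (auto simp: leaf_link_def)

text \<open>A link below level \<open>t\<close> leaves block distance at most 1 on level
  \<open>t\<close>, and a distance of at most 6 on level \<open>t\<close> shrinks to at most 2 on
  every higher level. Together with \<open>leaf_linkI\<close>, block distances 2 to 6 thus decide
  adjacency regardless of the positions inside the blocks.\<close>

lemma not_leaf_link:
  assumes "\<bar>x div 3 ^ t - y div 3 ^ t\<bar> \<in> {2, 4, 5, 6}"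
  shows "\<not> leaf_link x y"
proof
  assume "leaf_link x y"
  then obtain l where l: "\<bar>x div 3 ^ l - y div 3 ^ l\<bar> = 3" by (auto simp: leaf_link_def)
  consider k where "t = l + Suc k" | "t = l" | k where "l = t + Suc k"
    by (metis less_imp_Suc_add linorder_less_linear add_Suc_right)
  then show False
  proof cases
    case 1
    have "\<bar>x div 3 ^ t - y div 3 ^ t\<bar> \<le> 1"
      unfolding 1 div_power3_add by (rule abs_div_diff_le) (use l in auto)
    then show False using assms by auto
  next
    case 2
    then show False using assms l by auto
  next
    case 3
    have "\<bar>x div 3 ^ l - y div 3 ^ l\<bar> \<le> 2"
      unfolding 3 div_power3_add
    proof (rule abs_div_diff_le)
      have "(1::int) \<le> 3 ^ k" by simp
      moreover have "\<bar>x div 3 ^ t - y div 3 ^ t\<bar> \<le> 6" using assms by auto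
      ultimately show "\<bar>x div 3 ^ t - y div 3 ^ t\<bar> \<le> 2 * 3 ^ Suc k"
        unfolding power_Suc by linarith
    qed simp
    then show False using l by simp
  qed
qed

lemma div_reflect: "d > 0 \<Longrightarrow> (- 1 - x) div d = - 1 - x div (d::int)"
proof -
  assume d: "d > 0"
  have "- 1 - x = (- 1 - x div d) * d + (d - 1 - x mod d)"
    using div_mult_mod_eq[of x d] by (simp add: algebra_simps)
  moreover have "0 \<le> d - 1 - x mod d" "d - 1 - x mod d < d"
    using d pos_mod_bound[of d x] pos_mod_sign[of d x] by linarith+
  ultimately show ?thesis
    by (metis add.commute div_mult_self3 div_pos_pos_trivial add.right_neutral d less_irrefl)
qed

lemma div_reflect3 [simp]: "(- 1 - x) div 3 ^ t = - 1 - x div (3::int) ^ t"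
  by (rule div_reflect) simp

lemma leaf_link_reflect [simp]: "leaf_link (- 1 - x) (- 1 - y) = leaf_link x y"
  unfolding leaf_link_def div_reflect3 by (simp add: abs_minus_commute)

section \<open>Vertices that \<open>W\<close> cannot distinguish, and links between adjacent
  blocks\<close>

definition twins :: "int set \<Rightarrow> int \<Rightarrow> int \<Rightarrow> bool" where
  "twins W u u' \<longleftrightarrow> (\<forall>w\<in>W. leaf_link u w \<longleftrightarrow> leaf_link u' w)"

text \<open>A shift by \<open>3 ^ t\<close> is a shift by three blocks of level
  \<open>t - 1\<close>. At block distance 1, where adjacency is undecided, this supplies a linked
  pair for every \<open>y\<close>.\<close>

lemma leaf_link_shift: "t \<ge> 1 \<Longrightarrow> leaf_link (y - 3 ^ t) y"
proof -
  assume "t \<ge> 1"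
  then obtain s where s: "t = Suc s" by (cases t) auto
  have "(y - 3 * 3 ^ s) div 3 ^ s = y div 3 ^ s - (3::int)"
    using div_mult_self1[of "3 ^ s" y "-3::int"] by simp
  then show ?thesis by (intro leaf_linkI[of _ s]) (simp add: s)
qed

lemma leaf_link_sym: "leaf_link x y \<longleftrightarrow> leaf_link y x"
  by (auto simp: leaf_link_def abs_minus_commute)

lemma div_shift: "(y - 3 ^ t) div 3 ^ t = y div 3 ^ t - (1::int)"
  using div_mult_self1[of "3 ^ t" y "-1::int"] by simp

lemma ex_not_leaf_link_pred:
  assumes "t \<ge> 1"
  shows "\<exists>a. a div 3 ^ t = y div 3 ^ t - (1::int) \<and> \<not> leaf_link a y"
proof -
  obtain s where s: "t = Suc s" using assms by (cases t) auto
  define z where "z = y div 3 ^ s"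
  \<comment> \<open>Going back 2 or 4 blocks of level \<open>s\<close> avoids a link. Two blocks
    reach the preceding block of level \<open>t\<close> if \<open>z\<close> is a first child, four
    do so for a second or third child.\<close>
  define c :: int where "c = (if z mod 3 = 0 then 2 else 4)"
  have d: "(y - c * 3 ^ s) div 3 ^ s = z - c"
    using div_mult_self1[of "3 ^ s" y "-c"] by (simp add: z_def)
  have "(z - c) div 3 = z div 3 - 1"
    unfolding c_def by presburger
  then have "(y - c * 3 ^ s) div 3 ^ t = y div 3 ^ t - 1"
    unfolding s div_power3_Suc d by (simp add: z_def)
  moreover have "\<not> leaf_link (y - c * 3 ^ s) y"
    by (rule not_leaf_link[of _ s], unfold d, fold z_def) (simp add: c_def)
  ultimately show ?thesis by blast
qed

text \<open>Block \<open>r\<close> is completely linked to the blocks \<open>r - 3\<close> and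
  \<open>r + 3\<close> and not at all to \<open>r + 2\<close>, \<open>r + 4\<close>,
  \<open>r + 5\<close>. A vertex of \<open>U\<close> with a twin in block \<open>r\<close> must see
  \<open>W\<close> in the same way, so each deviation puts a position into \<open>U\<close>. Such
  deviations spread from one vertex to whole blocks.\<close>

lemma right_full:
  fixes U W :: "int set" and r :: int
  assumes t: "t \<ge> 1"
    and cover: "\<And>y. r - 3 \<le> y div 3 ^ t \<Longrightarrow> y div 3 ^ t \<le> r + 5 \<Longrightarrow> y \<in> U \<union> W"
    and fol: "\<And>a. a \<in> U \<Longrightarrow> r < a div 3 ^ t \<Longrightarrow> a div 3 ^ t \<le> r + 5 \<Longrightarrow>
      \<exists>u. u div 3 ^ t = r \<and> twins W a u"
  shows "\<And>y. (\<exists>a\<in>U. a div 3 ^ t \<in> {r + 1, r + 2}) \<or> (\<forall>y. y div 3 ^ t = r + 3 \<longrightarrow> y \<in> U)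
      \<Longrightarrow> r + 2 \<le> y div 3 ^ t \<Longrightarrow> y div 3 ^ t \<le> r + 5 \<Longrightarrow> y \<in> U" (is "\<And>y. ?P \<Longrightarrow> _ \<Longrightarrow> _ \<Longrightarrow> _")
    and "\<And>y. \<exists>a\<in>U. a div 3 ^ t \<in> {r + 1, r + 2} \<Longrightarrow> y div 3 ^ t = r - 3 \<Longrightarrow> y \<in> U"
proof -
  \<comment> \<open>A link that block \<open>r\<close> cannot have forces its endpoint out of
    \<open>W\<close>.\<close>
  have A: "w \<in> U" if "a \<in> U" "r < a div 3 ^ t" "a div 3 ^ t \<le> r + 5" "leaf_link a w"
    "w div 3 ^ t \<in> {r + 2, r + 4, r + 5}" for a w
  proof (rule ccontr)
    assume "w \<notin> U"
    then have "w \<in> W" using cover[of w] that by auto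
    with fol[OF that(1-3)] that(4) obtain u where "u div 3 ^ t = r" "leaf_link u w"
      by (auto simp: twins_def)
    then show False using not_leaf_link[of u t w] that(5) by auto
  qed
  \<comment> \<open>A missing link that block \<open>r\<close> does have forces its endpoint out of
    \<open>W\<close>.\<close>
  have N: "w \<in> U" if "a \<in> U" "r < a div 3 ^ t" "a div 3 ^ t \<le> r + 5" "\<not> leaf_link a w"
    "w div 3 ^ t \<in> {r + 3, r - 3}" for a w
  proof (rule ccontr)
    assume "w \<notin> U"
    then have "w \<in> W" using cover[of w] that by auto
    with fol[OF that(1-3)] that(4) obtain u where "u div 3 ^ t = r" "\<not> leaf_link u w"
      by (auto simp: twins_def)
    then show False using leaf_linkI[of u t w] that(5) by auto
  qed
  have two_five: "y \<in> U" if "a \<in> U" "a div 3 ^ t = r + 2" "y div 3 ^ t = r + 5" for a y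
    by (rule A[OF that(1)]) (use that leaf_linkI[of a t y] in auto)
  have five_two: "y \<in> U" if "a \<in> U" "a div 3 ^ t = r + 5" "y div 3 ^ t = r + 2" for a y
    by (rule A[OF that(1)]) (use that leaf_linkI[of a t y] in auto)
  have one_three: "y \<in> U" if "a \<in> U" "a div 3 ^ t = r + 1" "y div 3 ^ t = r + 3" for a y
    by (rule N[OF that(1)]) (use that not_leaf_link[of a t y] in auto)
  have shift: "y \<in> U" if "\<And>z. z div 3 ^ t = y div 3 ^ t - 1 \<Longrightarrow> z \<in> U"
    "y div 3 ^ t \<in> {r + 4, r + 5}" for y
    by (rule A[of "y - 3 ^ t"]) (use that t leaf_link_shift[of t y] in \<open>auto simp: div_shift\<close>)
  have two_three: "y \<in> U" if full: "\<And>z. z div 3 ^ t = r + 2 \<Longrightarrow> z \<in> U" and y: "y div 3 ^ t = r + 3" for y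
  proof -
    obtain a where "a div 3 ^ t = r + 2" "\<not> leaf_link a y"
      using ex_not_leaf_link_pred[OF t, of y] y by (auto simp: algebra_simps)
    then show ?thesis by (intro N[of a y]) (use full y in auto)
  qed
  define full where "full b \<longleftrightarrow> (\<forall>y. y div 3 ^ t = b \<longrightarrow> y \<in> U)" for b
  have fullD: "\<exists>a\<in>U. a div 3 ^ t = b" if "full b" for b
  proof
    show "b * 3 ^ t div 3 ^ t = b" by simp
    then show "b * 3 ^ t \<in> U" using that by (simp add: full_def)
  qed
  have nxt: "full (b + 1)" if "full b" "b = r + 3 \<or> b = r + 4" for b
    unfolding full_def
  proof (intro allI impI)
    fix y assume y: "y div 3 ^ t = b + 1"
    show "y \<in> U"
    proof (rule shift)
      show "z \<in> U" if "z div 3 ^ t = y div 3 ^ t - 1" for z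
        using that \<open>full b\<close> y unfolding full_def by simp
      show "y div 3 ^ t \<in> {r + 4, r + 5}" using y that(2) by auto
    qed
  qed
  have full_five_two: "full (r + 2)" if "full (r + 5)"
    using fullD[OF that] five_two unfolding full_def by blast
  \<comment> \<open>Full blocks spread as \<open>r + 3\<close>, \<open>r + 4\<close>,
    \<open>r + 5\<close> by shifts, and from \<open>r + 5\<close> back to \<open>r + 2\<close> by
    the complete links at distance 3.\<close>
  have three_all: "full (r + 2) \<and> full (r + 4) \<and> full (r + 5)" if "full (r + 3)"
    using nxt[of "r + 3"] nxt[of "r + 4"] that full_five_two by (simp add: algebra_simps)
  have two_all: "full (r + 3)" if "full (r + 2)"
    using two_three that unfolding full_def by blast
  fix y
  { assume P: ?P "r + 2 \<le> y div 3 ^ t" "y div 3 ^ t \<le> r + 5"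
    have "full (r + 3)"
      using P(1)
    proof (elim disjE bexE)
      fix a assume a: "a \<in> U" "a div 3 ^ t \<in> {r + 1, r + 2}"
      show ?thesis
      proof (cases "a div 3 ^ t = r + 1")
        case True
        then show ?thesis using a one_three unfolding full_def by blast
      next
        case False
        then have "full (r + 5)" using a two_five unfolding full_def by blast
        then show ?thesis using full_five_two two_all by blast
      qed
    qed (simp add: full_def)
    with three_all have "full (r + 2)" "full (r + 3)" "full (r + 4)" "full (r + 5)"
      by blast+
    moreover have "y div 3 ^ t = r + 2 \<or> y div 3 ^ t = r + 3 \<or> y div 3 ^ t = r + 4 \<or> y div 3 ^ t = r + 5"
      using P by linarith
    ultimately show "y \<in> U" unfolding full_def by blast }
  { assume "\<exists>a\<in>U. a div 3 ^ t \<in> {r + 1, r + 2}" and y: "y div 3 ^ t = r - 3"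
    then obtain a where "a \<in> U" "a div 3 ^ t \<in> {r + 1, r + 2}" by blast
    then show "y \<in> U" by (intro N[of a y]) (use y not_leaf_link[of a t y] in auto) }
qed

text \<open>The mirror image of \<open>right_full\<close> under the reflection
  \<open>\<rho>\<close>, which sends block \<open>b\<close> of each level to block
  \<open>- 1 - b\<close>.\<close>

lemma left_full:
  fixes U W :: "int set" and l :: int
  assumes t: "t \<ge> 1"
    and cover: "\<And>y. l - 5 \<le> y div 3 ^ t \<Longrightarrow> y div 3 ^ t \<le> l + 3 \<Longrightarrow> y \<in> U \<union> W"
    and fol: "\<And>a. a \<in> U \<Longrightarrow> a div 3 ^ t < l \<Longrightarrow> l - 5 \<le> a div 3 ^ t \<Longrightarrow>
      \<exists>u. u div 3 ^ t = l \<and> twins W a u"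
  shows "\<And>y. (\<exists>a\<in>U. a div 3 ^ t \<in> {l - 1, l - 2}) \<or> (\<forall>y. y div 3 ^ t = l - 3 \<longrightarrow> y \<in> U)
      \<Longrightarrow> l - 5 \<le> y div 3 ^ t \<Longrightarrow> y div 3 ^ t \<le> l - 2 \<Longrightarrow> y \<in> U"
    and "\<And>y. \<exists>a\<in>U. a div 3 ^ t \<in> {l - 1, l - 2} \<Longrightarrow> y div 3 ^ t = l + 3 \<Longrightarrow> y \<in> U"
proof -
  define \<rho> :: "int \<Rightarrow> int" where "\<rho> = (\<lambda>x. - 1 - x)"
  have \<rho>: "\<rho> (\<rho> x) = x" "\<rho> x div 3 ^ t = - 1 - x div 3 ^ t" "leaf_link (\<rho> x) (\<rho> y) = leaf_link x y" for x y t
    by (simp_all add: \<rho>_def)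
  have cover': "y \<in> \<rho> -` U \<union> \<rho> -` W" if "(- 1 - l) - 3 \<le> y div 3 ^ t" "y div 3 ^ t \<le> (- 1 - l) + 5" for y
    using cover[of "\<rho> y"] that by (simp add: \<rho>)
  have fol': "\<exists>u. u div 3 ^ t = - 1 - l \<and> twins (\<rho> -` W) a u"
    if "a \<in> \<rho> -` U" "- 1 - l < a div 3 ^ t" "a div 3 ^ t \<le> - 1 - l + 5" for a
  proof -
    have "\<rho> a \<in> U" "\<rho> a div 3 ^ t < l" "l - 5 \<le> \<rho> a div 3 ^ t"
      using that by (simp_all add: \<rho>)
    from fol[OF this] obtain u where "u div 3 ^ t = l" "twins W (\<rho> a) u"
      by blast
    then have "\<rho> u div 3 ^ t = - 1 - l \<and> twins (\<rho> -` W) a (\<rho> u)"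
      unfolding twins_def by (metis \<rho> vimage_eq)
    then show ?thesis by blast
  qed
  let ?P = "\<exists>a\<in>\<rho> -` U. a div 3 ^ t \<in> {- 1 - l + 1, - 1 - l + 2}"
  have R1: "y \<in> \<rho> -` U" if "?P \<or> (\<forall>y. y div 3 ^ t = - 1 - l + 3 \<longrightarrow> y \<in> \<rho> -` U)"
    "- 1 - l + 2 \<le> y div 3 ^ t" "y div 3 ^ t \<le> - 1 - l + 5" for y
    by (rule right_full(1)[where W = "\<rho> -` W", OF t]; (fact cover' fol' that)?)
  have R2: "y \<in> \<rho> -` U" if ?P "y div 3 ^ t = - 1 - l - 3" for y
    by (rule right_full(2)[where W = "\<rho> -` W", OF t]; (fact cover' fol' that)?)
  have P: ?P if "\<exists>a\<in>U. a div 3 ^ t \<in> {l - 1, l - 2}"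
  proof -
    from that obtain a where a: "a \<in> U" "a div 3 ^ t \<in> {l - 1, l - 2}" by blast
    show ?thesis
    proof
      show "\<rho> a \<in> \<rho> -` U" using a by (simp add: \<rho>)
      show "\<rho> a div 3 ^ t \<in> {- 1 - l + 1, - 1 - l + 2}" using a(2) unfolding \<rho> by auto
    qed
  qed
  have full: "\<forall>y. y div 3 ^ t = - 1 - l + 3 \<longrightarrow> y \<in> \<rho> -` U"
    if "\<forall>y. y div 3 ^ t = l - 3 \<longrightarrow> y \<in> U"
  proof (intro allI impI)
    fix y assume "y div 3 ^ t = - 1 - l + 3"
    then have "\<rho> y div 3 ^ t = l - 3" unfolding \<rho> by linarith
    with that show "y \<in> \<rho> -` U" by blast
  qed
  fix y
  { assume y: "(\<exists>a\<in>U. a div 3 ^ t \<in> {l - 1, l - 2}) \<or> (\<forall>y. y div 3 ^ t = l - 3 \<longrightarrow> y \<in> U)"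
      "l - 5 \<le> y div 3 ^ t" "y div 3 ^ t \<le> l - 2"
    have "\<rho> y \<in> \<rho> -` U"
      by (rule R1) (use P full y in \<open>blast, auto simp: \<rho>\<close>)
    then show "y \<in> U" by (simp add: \<rho>) }
  { assume y: "\<exists>a\<in>U. a div 3 ^ t \<in> {l - 1, l - 2}" "y div 3 ^ t = l + 3"
    have "\<rho> y \<in> \<rho> -` U"
      by (rule R2) (use P y in \<open>auto simp: \<rho>\<close>)
    then show "y \<in> U" by (simp add: \<rho>) }
qed

subsection \<open>Filling blocks\<close>

text \<open>The offsets are those reproduced on the next level: block \<open>r + 3\<close> of level \<open>t\<close> lies in the
  block just right of the one containing \<open>r\<close> on level \<open>t + 1\<close>, which restarts the filling there.\<close>

definition flanks_in :: "int set \<Rightarrow> nat \<Rightarrow> int \<Rightarrow> int \<Rightarrow> bool" where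
  "flanks_in U t l r \<longleftrightarrow> (\<forall>y. y div 3 ^ t \<in> {l - 5..l - 2} \<union> {r + 2..r + 5} \<longrightarrow> y \<in> U)"

text \<open>A vertex of \<open>U\<close> on one side fills that side and also a block at distance 3
  on the opposite side, by the second part of \<open>right_full\<close> or \<open>left_full\<close>.
  This starts the filling there.\<close>

lemma flanks_in_step:
  fixes U W :: "int set" and l r :: int
  assumes t: "t \<ge> 1" and lr: "r = l \<or> r = l + 1"
    and cover: "\<And>y. l - 5 \<le> y div 3 ^ t \<Longrightarrow> y div 3 ^ t \<le> r + 5 \<Longrightarrow> y \<in> U \<union> W"
    and folR: "\<And>a. a \<in> U \<Longrightarrow> r < a div 3 ^ t \<Longrightarrow> a div 3 ^ t \<le> r + 5 \<Longrightarrow>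
      \<exists>u. u div 3 ^ t = r \<and> twins W a u"
    and folL: "\<And>a. a \<in> U \<Longrightarrow> a div 3 ^ t < l \<Longrightarrow> l - 5 \<le> a div 3 ^ t \<Longrightarrow>
      \<exists>u. u div 3 ^ t = l \<and> twins W a u"
    and a: "a \<in> U" "a div 3 ^ t \<in> {l - 2, l - 1, r + 1, r + 2}"
  shows "flanks_in U t l r"
proof -
  have coverR: "y \<in> U \<union> W" if "r - 3 \<le> y div 3 ^ t" "y div 3 ^ t \<le> r + 5" for y
    by (rule cover) (use that lr in auto)
  have coverL: "y \<in> U \<union> W" if "l - 5 \<le> y div 3 ^ t" "y div 3 ^ t \<le> l + 3" for y
    by (rule cover) (use that lr in auto)
  let ?PR = "\<exists>a\<in>U. a div 3 ^ t \<in> {r + 1, r + 2}" and ?PL = "\<exists>a\<in>U. a div 3 ^ t \<in> {l - 1, l - 2}"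
  have R1: "y \<in> U" if "?PR \<or> (\<forall>y. y div 3 ^ t = r + 3 \<longrightarrow> y \<in> U)"
    "r + 2 \<le> y div 3 ^ t" "y div 3 ^ t \<le> r + 5" for y
    by (rule right_full(1)[where W = W, OF t]; (fact coverR folR that)?)
  have R2: "y \<in> U" if ?PR "y div 3 ^ t = r - 3" for y
    by (rule right_full(2)[where W = W, OF t]; (fact coverR folR that)?)
  have L1: "y \<in> U" if "?PL \<or> (\<forall>y. y div 3 ^ t = l - 3 \<longrightarrow> y \<in> U)"
    "l - 5 \<le> y div 3 ^ t" "y div 3 ^ t \<le> l - 2" for y
    by (rule left_full(1)[where W = W, OF t]; (fact coverL folL that)?)
  have L2: "y \<in> U" if ?PL "y div 3 ^ t = l + 3" for y
    by (rule left_full(2)[where W = W, OF t]; (fact coverL folL that)?)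
  have ne: "b * 3 ^ t div 3 ^ t = b" for b :: int by simp
  have prems: "(?PR \<or> (\<forall>y. y div 3 ^ t = r + 3 \<longrightarrow> y \<in> U)) \<and> (?PL \<or> (\<forall>y. y div 3 ^ t = l - 3 \<longrightarrow> y \<in> U))"
  proof -
    consider ?PR | ?PL using a by blast
    then show ?thesis
    proof cases
      case 1
      show ?thesis
      proof (cases "r = l")
        case True
        then show ?thesis using 1 R2 by blast
      next
        case False
        \<comment> \<open>With two adjacent core blocks the filled block \<open>r - 3\<close> is
          \<open>l - 2\<close>, so any of its positions, here the first, serves as a start on the
          left; for \<open>r = l\<close> it is \<open>l - 3\<close>, which may be given as
          full.\<close>
        then have "(l - 2) * 3 ^ t div 3 ^ t = r - 3" using lr by simp
        then have "(l - 2) * 3 ^ t \<in> U" by (rule R2[OF 1])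
        then have ?PL by (intro bexI[of _ "(l - 2) * 3 ^ t"]) simp_all
        then show ?thesis using 1 by blast
      qed
    next
      case 2
      show ?thesis
      proof (cases "r = l")
        case True
        then show ?thesis using 2 L2 by blast
      next
        case False
        then have "(r + 2) * 3 ^ t div 3 ^ t = l + 3" using lr by simp
        then have "(r + 2) * 3 ^ t \<in> U" by (rule L2[OF 2])
        then have ?PR by (intro bexI[of _ "(r + 2) * 3 ^ t"]) simp_all
        then show ?thesis using 2 by blast
      qed
    qed
  qed
  show ?thesis
    unfolding flanks_in_def
  proof (intro allI impI)
    fix y assume "y div 3 ^ t \<in> {l - 5..l - 2} \<union> {r + 2..r + 5}"
    then show "y \<in> U"
      using R1[OF conjunct1[OF prems], of y] L1[OF conjunct2[OF prems], of y] unfolding Un_iff atLeastAtMost_iff by blast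
  qed
qed

lemma flanks_in_next:
  assumes "flanks_in U t l r"
  shows "\<exists>a\<in>U. a div 3 ^ Suc t = r div 3 + 1"
proof
  show "(r + 3) * 3 ^ t \<in> U" using assms by (simp add: flanks_in_def)
  show "(r + 3) * 3 ^ t div 3 ^ Suc t = r div 3 + 1"
    unfolding div_power3_Suc by simp
qed

text \<open>Every position in the blocks \<open>l - 3\<close>, \<open>l - 2\<close>, \<open>l + 3\<close>, \<open>l + 4\<close> is linked to exactly one of
  the blocks \<open>l\<close> and \<open>l + 1\<close>, so it cannot lie in \<open>W\<close> as soon as two twins sit in different blocks.\<close>

lemma flanks_in_split:
  fixes U W :: "int set" and l :: int
  assumes t: "t \<ge> 1"
    and cover: "\<And>y. l - 5 \<le> y div 3 ^ t \<Longrightarrow> y div 3 ^ t \<le> l + 6 \<Longrightarrow> y \<in> U \<union> W"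
    and fol: "\<And>a. a \<in> U \<Longrightarrow> l - 5 \<le> a div 3 ^ t \<Longrightarrow> a div 3 ^ t \<le> l + 6 \<Longrightarrow>
      \<exists>u. u div 3 ^ t \<in> {l, l + 1} \<and> twins W a u"
    and au: "a div 3 ^ t \<in> {l, l + 1}" "u div 3 ^ t \<in> {l, l + 1}"
      "a div 3 ^ t \<noteq> u div 3 ^ t" "twins W a u"
  shows "flanks_in U t l (l + 1)"
proof -
  have split: "w \<in> U" if w: "w div 3 ^ t \<in> {l - 3, l - 2, l + 3, l + 4}" for w
  proof (rule ccontr)
    assume "w \<notin> U"
    then have w': "leaf_link a w \<longleftrightarrow> leaf_link u w" using cover[of w] w au(4) by (auto simp: twins_def)
    have "(\<bar>a div 3 ^ t - w div 3 ^ t\<bar> = 3 \<and> \<bar>u div 3 ^ t - w div 3 ^ t\<bar> \<in> {2, 4}) \<or>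
      (\<bar>u div 3 ^ t - w div 3 ^ t\<bar> = 3 \<and> \<bar>a div 3 ^ t - w div 3 ^ t\<bar> \<in> {2, 4})"
      using au(1-3) w by auto
    then show False
      using leaf_linkI[of a t w] leaf_linkI[of u t w] not_leaf_link[of a t w] not_leaf_link[of u t w] w' by auto
  qed
  \<comment> \<open>These four blocks have distance 4, 5 or 6 from both core blocks, so a vertex of
    \<open>W\<close> there is linked to no twin candidate. They are then filled by links from the
    four blocks already obtained.\<close>
  have anti: "w \<in> U" if b: "b \<in> U" "l - 5 \<le> b div 3 ^ t" "b div 3 ^ t \<le> l + 6" and "leaf_link b w"
    and w: "w div 3 ^ t \<in> {l - 5, l - 4, l + 5, l + 6}" for b w
  proof (rule ccontr)
    assume "w \<notin> U"
    then have "w \<in> W" using cover[of w] w by auto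
    with fol[OF b] \<open>leaf_link b w\<close> obtain v where v: "v div 3 ^ t \<in> {l, l + 1}" "leaf_link v w"
      by (auto simp: twins_def)
    moreover have "\<bar>v div 3 ^ t - w div 3 ^ t\<bar> \<in> {2, 4, 5, 6}" using v(1) w by auto
    ultimately show False using not_leaf_link by blast
  qed
  have "w \<in> U" if w: "w div 3 ^ t = l + 6" for w
  proof (rule anti)
    show "(l + 3) * 3 ^ t \<in> U" by (rule split) simp
    show "leaf_link ((l + 3) * 3 ^ t) w" by (rule leaf_linkI[of _ t]) (simp add: w)
  qed (simp_all add: w)
  moreover have "w \<in> U" if w: "w div 3 ^ t = l - 5" for w
  proof (rule anti)
    show "(l - 2) * 3 ^ t \<in> U" by (rule split) simp
    show "leaf_link ((l - 2) * 3 ^ t) w" by (rule leaf_linkI[of _ t]) (simp add: w)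
  qed (simp_all add: w)
  moreover have "w \<in> U" if w: "w div 3 ^ t = l + 5" for w
  proof (rule anti)
    have "(w - 3 ^ t) div 3 ^ t = l + 4" by (simp add: div_shift w)
    then show "w - 3 ^ t \<in> U" "l - 5 \<le> (w - 3 ^ t) div 3 ^ t" "(w - 3 ^ t) div 3 ^ t \<le> l + 6"
      by (auto intro: split)
    show "leaf_link (w - 3 ^ t) w" by (rule leaf_link_shift[OF t])
  qed (simp_all add: w)
  moreover have "w \<in> U" if w: "w div 3 ^ t = l - 4" for w
  proof (rule anti)
    have "(w + 3 ^ t) div 3 ^ t = l - 3" using div_shift[of "w + 3 ^ t" t] w by simp
    then show "w + 3 ^ t \<in> U" "l - 5 \<le> (w + 3 ^ t) div 3 ^ t" "(w + 3 ^ t) div 3 ^ t \<le> l + 6"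
      by (auto intro: split)
    show "leaf_link (w + 3 ^ t) w" using leaf_link_shift[OF t, of "w + 3 ^ t"] by (simp add: leaf_link_sym)
  qed (simp_all add: w)
  moreover have "y div 3 ^ t \<in> {l - 3, l - 2, l + 3, l + 4} \<or> y div 3 ^ t = l + 6 \<or> y div 3 ^ t = l - 5
    \<or> y div 3 ^ t = l + 5 \<or> y div 3 ^ t = l - 4"
    if "y div 3 ^ t \<in> {l - 5..l - 2} \<union> {l + 1 + 2..l + 1 + 5}" for y
    using that by auto
  ultimately show ?thesis using split unfolding flanks_in_def by blast
qed

lemma le_div_iff:
  assumes "d > 0"
  shows "b \<le> x div d \<longleftrightarrow> b * (d::int) \<le> x"
proof
  assume "b \<le> x div d"
  then have "b * d \<le> x div d * d" using assms by (simp add: mult_right_mono)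
  also have "\<dots> \<le> x" using assms div_mult_mod_eq[of x d] pos_mod_sign[of d x] by linarith
  finally show "b * d \<le> x" .
next
  assume "b * d \<le> x"
  then have "b * d div d \<le> x div d" using assms by (intro zdiv_mono1)
  then show "b \<le> x div d" using assms by simp
qed

lemma div_less_iff: "d > 0 \<Longrightarrow> x div d < b \<longleftrightarrow> x < b * (d::int)"
  using le_div_iff[of d b x] by linarith

text \<open>The flanks of consecutive levels leave no gap: the first block missed on the right,
  \<open>R + 6\<close>, lies in block \<open>R div 3 + 2\<close> of the next level, where the next
  flank begins; likewise on the left.\<close>

lemma flanks_in_cover:
  fixes l r :: int
  assumes "\<And>i. i \<le> n \<Longrightarrow> flanks_in U (t + i) (l div 3 ^ i) (r div 3 ^ i)"
  shows "\<And>y. r + 2 \<le> y div 3 ^ t \<Longrightarrow> y div 3 ^ (t + n) \<le> r div 3 ^ n + 5 \<Longrightarrow> y \<in> U"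
    and "\<And>y. y div 3 ^ t \<le> l - 2 \<Longrightarrow> l div 3 ^ n - 5 \<le> y div 3 ^ (t + n) \<Longrightarrow> y \<in> U"
proof -
  have "(r + 2 \<le> y div 3 ^ t \<longrightarrow> y div 3 ^ (t + n) \<le> r div 3 ^ n + 5 \<longrightarrow> y \<in> U) \<and>
    (y div 3 ^ t \<le> l - 2 \<longrightarrow> l div 3 ^ n - 5 \<le> y div 3 ^ (t + n) \<longrightarrow> y \<in> U)" for y
    using assms
  proof (induction n)
    case 0
    then show ?case by (auto simp: flanks_in_def)
  next
    case (Suc n)
    have IH: "(r + 2 \<le> y div 3 ^ t \<longrightarrow> y div 3 ^ (t + n) \<le> r div 3 ^ n + 5 \<longrightarrow> y \<in> U) \<and>
      (y div 3 ^ t \<le> l - 2 \<longrightarrow> l div 3 ^ n - 5 \<le> y div 3 ^ (t + n) \<longrightarrow> y \<in> U)"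
      by (rule Suc.IH) (use Suc.prems in auto)
    have g: "flanks_in U (t + Suc n) (l div 3 ^ n div 3) (r div 3 ^ n div 3)"
      using Suc.prems[of "Suc n"] by (simp only: div_power3_Suc le_refl)
    define z R L where zRL: "z = y div 3 ^ (t + n)" "R = r div 3 ^ n" "L = l div 3 ^ n"
    have y: "y div 3 ^ (t + Suc n) = z div 3"
      by (simp only: add_Suc_right div_power3_Suc zRL)
    have gI: "y \<in> U" if "z div 3 \<in> {L div 3 - 5..L div 3 - 2} \<union> {R div 3 + 2..R div 3 + 5}"
    proof -
      from g have "y div 3 ^ (t + Suc n) \<in> {L div 3 - 5..L div 3 - 2} \<union> {R div 3 + 2..R div 3 + 5} \<longrightarrow> y \<in> U"
        unfolding flanks_in_def zRL by (rule spec)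
      then show ?thesis using that unfolding y by (rule mp)
    qed
    have "y \<in> U" if "R + 5 < z" "z div 3 \<le> R div 3 + 5"
    proof -
      have "R div 3 + 2 \<le> z div 3" using that(1) by presburger
      then show ?thesis using that(2) by (intro gI) auto
    qed
    moreover have "y \<in> U" if "z < L - 5" "L div 3 - 5 \<le> z div 3"
    proof -
      have "z div 3 \<le> L div 3 - 2" using that(1) by presburger
      then show ?thesis using that(2) by (intro gI) auto
    qed
    moreover have "(r + 2 \<le> y div 3 ^ t \<longrightarrow> z \<le> R + 5 \<longrightarrow> y \<in> U) \<and> (y div 3 ^ t \<le> l - 2 \<longrightarrow> L - 5 \<le> z \<longrightarrow> y \<in> U)"
      using IH by (simp only: zRL)
    ultimately show ?case
      unfolding y div_power3_Suc[of r] div_power3_Suc[of l] zRL(2,3)[symmetric]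
      by (meson not_le)
  qed
  then show "\<And>y. r + 2 \<le> y div 3 ^ t \<Longrightarrow> y div 3 ^ (t + n) \<le> r div 3 ^ n + 5 \<Longrightarrow> y \<in> U"
    and "\<And>y. y div 3 ^ t \<le> l - 2 \<Longrightarrow> l div 3 ^ n - 5 \<le> y div 3 ^ (t + n) \<Longrightarrow> y \<in> U"
    by blast+
qed

text \<open>Near \<open>p\<close> only the blocks \<open>l - 1\<close> to \<open>r + 1\<close> of
  level \<open>t\<close> remain for \<open>W\<close>, which are at most 4. Three levels up, density
  demands \<open>9 * 3 ^ t\<close> vertices of \<open>W\<close>.\<close>

lemma flanks_in_contradiction:
  fixes l r p :: int
  assumes flanks_in: "\<And>i. i \<le> 3 \<Longrightarrow> flanks_in U (t + i) (l div 3 ^ i) (r div 3 ^ i)"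
    and lr: "r = l \<or> r = l + 1" and p: "p div 3 ^ t \<in> {l, r}" and disj: "U \<inter> W = {}"
    and dens: "3 ^ (t + 3) \<le> 3 * card (W \<inter> {p - 3 ^ (t + 3)<..<p + 3 ^ (t + 3)})"
  shows False
proof -
  have x3: "p div 3 ^ (t + 3) = p div 3 ^ t div 3 ^ 3" by (rule div_power3_add)
  have mono: "l div 3 ^ 3 \<le> p div 3 ^ (t + 3)" "p div 3 ^ (t + 3) \<le> r div 3 ^ 3"
    unfolding x3 using p lr by (auto intro!: zdiv_mono1)
  have "W \<inter> {p - 3 ^ (t + 3)<..<p + 3 ^ (t + 3)} \<subseteq> {(l - 1) * 3 ^ t..<(r + 2) * 3 ^ t}"
  proof
    fix y assume y: "y \<in> W \<inter> {p - 3 ^ (t + 3)<..<p + 3 ^ (t + 3)}"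
    then have "\<bar>y div 3 ^ (t + 3) - p div 3 ^ (t + 3)\<bar> \<le> 1"
      by (intro abs_div_diff_le) auto
    then have "y div 3 ^ (t + 3) \<le> r div 3 ^ 3 + 5" "l div 3 ^ 3 - 5 \<le> y div 3 ^ (t + 3)"
      using mono by linarith+
    moreover have "y \<notin> U" using y disj by auto
    ultimately have "\<not> r + 2 \<le> y div 3 ^ t" "\<not> y div 3 ^ t \<le> l - 2"
      using flanks_in_cover[where n = 3, OF flanks_in] by blast+
    then show "y \<in> {(l - 1) * 3 ^ t..<(r + 2) * 3 ^ t}"
      using div_less_iff[of "3 ^ t" y "r + 2"] le_div_iff[of "3 ^ t" "l - 1" y] by auto
  qed
  then have "card (W \<inter> {p - 3 ^ (t + 3)<..<p + 3 ^ (t + 3)}) \<le> card {(l - 1) * 3 ^ t..<(r + 2) * 3 ^ t}"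
    by (intro card_mono) auto
  also have "\<dots> = nat ((r - l + 3) * 3 ^ t)" by (simp add: algebra_simps)
  also have "\<dots> \<le> nat (4 * 3 ^ t)"
    by (intro nat_mono mult_right_mono) (use lr in auto)
  also have "\<dots> = 4 * 3 ^ t" by (simp add: nat_mult_distrib nat_power_eq)
  finally have "3 ^ (t + 3) \<le> 12 * (3::nat) ^ t" using dens by linarith
  then show False by (simp add: power_add)
qed

text \<open>Density gives more vertices of \<open>U\<close> than the two core blocks can hold, hence
  one outside them. Its block offset from the core stays at least 1 going up as long as it was at
  least 3, and is at most 1 on level \<open>t + 2\<close>, so on one of the three levels it is 1 or
  2.\<close>

lemma start_level:
  fixes l r p :: int
  assumes lr: "r = l \<or> r = l + 1" and p: "p div 3 ^ t \<in> {l, r}"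
    and dens: "3 ^ (t + 2) \<le> 3 * card (U \<inter> {p - 3 ^ (t + 2)<..<p + 3 ^ (t + 2)})"
  shows "\<exists>i\<le>2. \<exists>a\<in>U. a div 3 ^ (t + i) \<in>
    {l div 3 ^ i - 2, l div 3 ^ i - 1, r div 3 ^ i + 1, r div 3 ^ i + 2}"
proof -
  have "\<not> U \<inter> {p - 3 ^ (t + 2)<..<p + 3 ^ (t + 2)} \<subseteq> {l * 3 ^ t..<(r + 1) * 3 ^ t}"
  proof
    assume "U \<inter> {p - 3 ^ (t + 2)<..<p + 3 ^ (t + 2)} \<subseteq> {l * 3 ^ t..<(r + 1) * 3 ^ t}"
    then have "card (U \<inter> {p - 3 ^ (t + 2)<..<p + 3 ^ (t + 2)}) \<le> card {l * 3 ^ t..<(r + 1) * 3 ^ t}"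
      by (intro card_mono) auto
    also have "\<dots> = nat ((r - l + 1) * 3 ^ t)" by (simp add: algebra_simps)
    also have "\<dots> \<le> nat (2 * 3 ^ t)"
      by (intro nat_mono mult_right_mono) (use lr in auto)
    also have "\<dots> = 2 * 3 ^ t" by (simp add: nat_mult_distrib nat_power_eq)
    finally have "3 ^ (t + 2) \<le> 6 * (3::nat) ^ t" using dens by linarith
    then show False by (simp add: power_add)
  qed
  then obtain a where a: "a \<in> U" "p - 3 ^ (t + 2) < a" "a < p + 3 ^ (t + 2)"
    "\<not> (l \<le> a div 3 ^ t \<and> a div 3 ^ t \<le> r)"
    using div_less_iff[of "3 ^ t" _ "r + 1"] le_div_iff[of "3 ^ t" l] by force
  define z where "z = a div 3 ^ t"
  have lev: "a div 3 ^ (t + 1) = z div 3" "a div 3 ^ (t + 2) = z div 9"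
    unfolding z_def div_power3_add by simp_all
  have "\<bar>a div 3 ^ (t + 2) - p div 3 ^ (t + 2)\<bar> \<le> 1"
    using a by (intro abs_div_diff_le) auto
  moreover have "p div 3 ^ (t + 2) = p div 3 ^ t div 9" unfolding div_power3_add by simp
  moreover have "l div 9 \<le> p div 3 ^ t div 9" "p div 3 ^ t div 9 \<le> r div 9"
    using p lr by (auto intro!: zdiv_mono1)
  ultimately have z9: "z div 9 \<le> r div 9 + 1" "l div 9 - 1 \<le> z div 9" using lev(2) by linarith+
  have step: "x div 3 \<le> y div 3 - 1" if "x \<le> y - 3" for x y :: int
    using that by presburger
  have d9: "x div 9 = x div 3 div 3" for x :: int by presburger
  have "z < l \<or> z > r" using a(4) by (auto simp: z_def)
  then have "z \<in> {l - 2, l - 1, r + 1, r + 2} \<or> z div 3 \<in> {l div 3 - 2, l div 3 - 1, r div 3 + 1, r div 3 + 2}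
     \<or> z div 9 \<in> {l div 9 - 2, l div 9 - 1, r div 9 + 1, r div 9 + 2}"
  proof
    assume "z < l"
    then have "z = l - 2 \<or> z = l - 1 \<or> z \<le> l - 3" by linarith
    moreover have "z div 3 = l div 3 - 2 \<or> z div 3 = l div 3 - 1 \<or> z div 3 \<le> l div 3 - 3"
      if "z \<le> l - 3" using step[OF that] by linarith
    moreover have "z div 9 = l div 9 - 1" if "z div 3 \<le> l div 3 - 3"
      using step[OF that] z9 unfolding d9 by linarith
    ultimately show ?thesis by blast
  next
    assume "z > r"
    then have "z = r + 1 \<or> z = r + 2 \<or> r \<le> z - 3" by linarith
    moreover have "z div 3 = r div 3 + 1 \<or> z div 3 = r div 3 + 2 \<or> r div 3 \<le> z div 3 - 3"
      if "r \<le> z - 3" using step[OF that] by linarith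
    moreover have "z div 9 = r div 9 + 1" if "r div 3 \<le> z div 3 - 3"
      using step[OF that] z9 unfolding d9 by linarith
    ultimately show ?thesis by blast
  qed
  then have "a div 3 ^ (t + 0) \<in> {l div 3 ^ 0 - 2, l div 3 ^ 0 - 1, r div 3 ^ 0 + 1, r div 3 ^ 0 + 2} \<or>
    a div 3 ^ (t + 1) \<in> {l div 3 ^ 1 - 2, l div 3 ^ 1 - 1, r div 3 ^ 1 + 1, r div 3 ^ 1 + 2} \<or>
    a div 3 ^ (t + 2) \<in> {l div 3 ^ 2 - 2, l div 3 ^ 2 - 1, r div 3 ^ 2 + 1, r div 3 ^ 2 + 2}"
    unfolding lev by (simp add: z_def)
  then consider i where "i \<le> 2" "a div 3 ^ (t + i) \<in>
    {l div 3 ^ i - 2, l div 3 ^ i - 1, r div 3 ^ i + 1, r div 3 ^ i + 2}"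
    by (elim disjE) (rule that[of 0], simp, assumption, rule that[of 1], simp, assumption,
      rule that[of 2], simp, assumption)
  then show ?thesis using a(1) by blast
qed

subsection \<open>Neighbourhood types around a position\<close>

lemma div_pair:
  fixes l r :: int
  assumes "r = l \<or> r = l + 1"
  shows "r div 3 ^ i = l div 3 ^ i \<or> r div 3 ^ i = l div 3 ^ i + 1"
proof -
  have "l div 3 ^ i \<le> r div 3 ^ i" using assms by (intro zdiv_mono1) auto
  moreover have "\<bar>r div 3 ^ i - l div 3 ^ i\<bar> \<le> 1"
    using assms by (intro abs_div_diff_le) auto
  ultimately show ?thesis by linarith
qed

lemma near_if_blocks_near:
  fixes x y :: int
  assumes "\<bar>y div 3 ^ t - x div 3 ^ t\<bar> \<le> 8"
  shows "\<bar>y - x\<bar> < 3 ^ (t + 2)"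
proof -
  have b: "z div 3 ^ t * 3 ^ t \<le> z" "z < (z div 3 ^ t + 1) * 3 ^ t" for z :: int
    using le_div_iff[of "3 ^ t" "z div 3 ^ t" z] div_less_iff[of "3 ^ t" z "z div 3 ^ t + 1"] by auto
  have "(y div 3 ^ t - x div 3 ^ t) * 3 ^ t \<le> 8 * 3 ^ t"
    "(x div 3 ^ t - y div 3 ^ t) * 3 ^ t \<le> 8 * 3 ^ t"
    by (intro mult_right_mono; use assms in simp)+
  then have "\<bar>y - x\<bar> < 9 * 3 ^ t" using b[of x] b[of y] by (simp add: algebra_simps)
  then show ?thesis by (simp add: power_add)
qed

text \<open>\<open>start_level\<close> finds a start on one of the levels \<open>t\<close> to
  \<open>t + 2\<close>, and the flanks then reproduce themselves on three further levels, up to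
  \<open>t + 5\<close>. Looking at blocks of that level requires a covered radius of
  \<open>3 ^ (t + 7)\<close>.\<close>

lemma follow_contradiction:
  fixes U W :: "int set" and l r p :: int
  assumes t: "t \<ge> 1" and lr: "r = l \<or> r = l + 1" and p: "p div 3 ^ t \<in> {l, r}"
    and disj: "U \<inter> W = {}"
    and cover: "\<And>y. \<bar>y - p\<bar> < 3 ^ (t + 7) \<Longrightarrow> y \<in> U \<union> W"
    and densU: "3 ^ (t + 2) \<le> 3 * card (U \<inter> {p - 3 ^ (t + 2)<..<p + 3 ^ (t + 2)})"
    and densW: "\<And>i. i \<le> 5 \<Longrightarrow> 3 ^ (t + i) \<le> 3 * card (W \<inter> {p - 3 ^ (t + i)<..<p + 3 ^ (t + i)})"
    and folR: "\<And>a i. i \<le> 5 \<Longrightarrow> a \<in> U \<Longrightarrow> r div 3 ^ i < a div 3 ^ (t + i) \<Longrightarrow>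
      a div 3 ^ (t + i) \<le> r div 3 ^ i + 5 \<Longrightarrow> \<exists>u. u div 3 ^ (t + i) = r div 3 ^ i \<and> twins W a u"
    and folL: "\<And>a i. i \<le> 5 \<Longrightarrow> a \<in> U \<Longrightarrow> a div 3 ^ (t + i) < l div 3 ^ i \<Longrightarrow>
      l div 3 ^ i - 5 \<le> a div 3 ^ (t + i) \<Longrightarrow> \<exists>u. u div 3 ^ (t + i) = l div 3 ^ i \<and> twins W a u"
  shows False
proof -
  have p': "p div 3 ^ (t + i) \<in> {l div 3 ^ i, r div 3 ^ i}" for i
    using p by (auto simp: div_power3_add)
  have cov: "y \<in> U \<union> W" if i: "i \<le> 5" and y: "l div 3 ^ i - 5 \<le> y div 3 ^ (t + i)"
    "y div 3 ^ (t + i) \<le> r div 3 ^ i + 5" for y i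
  proof (rule cover)
    have "\<bar>y div 3 ^ (t + i) - p div 3 ^ (t + i)\<bar> \<le> 8"
      using y p'[of i] div_pair[OF lr, of i] by auto
    then have "\<bar>y - p\<bar> < 3 ^ (t + i + 2)" by (rule near_if_blocks_near)
    also have "\<dots> \<le> 3 ^ (t + 7)" using i by (intro power_increasing) auto
    finally show "\<bar>y - p\<bar> < 3 ^ (t + 7)" .
  qed
  have step: "flanks_in U (t + i) (l div 3 ^ i) (r div 3 ^ i)" if i: "i \<le> 5" and "a \<in> U"
    "a div 3 ^ (t + i) \<in> {l div 3 ^ i - 2, l div 3 ^ i - 1, r div 3 ^ i + 1, r div 3 ^ i + 2}" for a i
    by (rule flanks_in_step[where W = W, OF _ div_pair[OF lr]]; (fact cov[OF i] folR[OF i] folL[OF i] that)?) (use t in simp)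
  obtain i a where ia: "i \<le> 2" "a \<in> U"
    "a div 3 ^ (t + i) \<in> {l div 3 ^ i - 2, l div 3 ^ i - 1, r div 3 ^ i + 1, r div 3 ^ i + 2}"
    using start_level[OF lr p densU] by blast
  \<comment> \<open>A filled flank contains a vertex just right of the core one level up, which is a
    start for the next \<open>step\<close>.\<close>
  have flanks_in: "flanks_in U (t + (i + k)) (l div 3 ^ (i + k)) (r div 3 ^ (i + k))" if "k \<le> 3" for k
    using that
  proof (induction k)
    case 0
    then show ?case using step[OF _ ia(2,3)] ia(1) by simp
  next
    case (Suc k)
    obtain b where b: "b \<in> U" "b div 3 ^ (t + (i + Suc k)) = r div 3 ^ (i + Suc k) + 1"
      using flanks_in_next[OF Suc.IH] Suc.prems by (auto simp: div_power3_Suc simp del: power_Suc)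
    show ?case by (rule step[OF _ b(1)]) (use b(2) Suc.prems ia(1) in auto)
  qed
  show False
  proof (rule flanks_in_contradiction)
    show "flanks_in U (t + i + k) (l div 3 ^ i div 3 ^ k) (r div 3 ^ i div 3 ^ k)" if "k \<le> 3" for k
      using flanks_in[OF that] by (simp only: div_power3_add add.assoc)
    show "3 ^ (t + i + 3) \<le> 3 * card (W \<inter> {p - 3 ^ (t + i + 3)<..<p + 3 ^ (t + i + 3)})"
      using densW[of "i + 3"] ia(1) by (simp add: add.assoc)
  qed (use div_pair[OF lr] p' disj in auto)
qed

lemma dvd_if_div_succ_neq:
  fixes q d :: int
  assumes "d > 0" "q div d \<noteq> (q + 1) div d"
  shows "d dvd q + 1"
proof -
  have "(q + 1) mod d = 0"
  proof (rule ccontr)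
    assume "(q + 1) mod d \<noteq> 0"
    then have "0 \<le> (q + 1) mod d - 1" "(q + 1) mod d - 1 < d"
      using assms(1) pos_mod_sign[of d "q + 1"] pos_mod_bound[of d "q + 1"] by linarith+
    moreover have "q = (q + 1) mod d - 1 + (q + 1) div d * d"
      using div_mult_mod_eq[of "q + 1" d] by linarith
    ultimately have "q div d = (q + 1) div d"
      using assms(1) by (metis div_mult_self1 div_pos_pos_trivial add.right_neutral less_irrefl)
    then show False using assms(2) by blast
  qed
  then show ?thesis by (simp add: dvd_eq_mod_eq_0)
qed

text \<open>All twins near \<open>p\<close> sit in at most two adjacent blocks on each level. Either
  these merge by level \<open>j + 10\<close>, so that twins share one block from there on, or a
  persistent boundary separates them and twins can be shown to stay on their own side.\<close>

lemma not_all_twins_near: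
  fixes U W :: "int set" and p :: int
  assumes disj: "U \<inter> W = {}"
    and cover: "\<And>y. \<bar>y - p\<bar> < 3 ^ (m + 20) \<Longrightarrow> y \<in> U \<union> W"
    and densU: "\<And>t. 1 \<le> t \<Longrightarrow> t \<le> m + 18 \<Longrightarrow> 3 ^ t \<le> 3 * card (U \<inter> {p - 3 ^ t<..<p + 3 ^ t})"
    and densW: "\<And>t. 1 \<le> t \<Longrightarrow> t \<le> m + 18 \<Longrightarrow> 3 ^ t \<le> 3 * card (W \<inter> {p - 3 ^ t<..<p + 3 ^ t})"
    and twin: "\<And>a. a \<in> U \<Longrightarrow> \<bar>a - p\<bar> < 3 ^ (m + 20) \<Longrightarrow>
      \<exists>u\<in>U. \<bar>u - p\<bar> < 3 ^ (m + 2) \<and> twins W a u"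
  shows False
proof -
  \<comment> \<open>The near window is shorter than \<open>3 ^ j\<close>, so it meets only block
    \<open>q\<close> of its left end and block \<open>q + 1\<close>; \<open>l i\<close> and
    \<open>r i\<close> are their ancestors \<open>i\<close> levels up.\<close>
  define j where "j = m + 3"
  define q where "q = (p - 3 ^ (m + 2)) div 3 ^ j"
  define l r where "l i = q div 3 ^ i" and "r i = (q + 1) div 3 ^ i" for i :: nat
  have lr: "r i = l i \<or> r i = l i + 1" for i
    unfolding l_def r_def by (rule div_pair) simp
  have lr_add: "l (i + k) = l i div 3 ^ k" "r (i + k) = r i div 3 ^ k" for i k
    unfolding l_def r_def by (rule div_power3_add)+
  have core: "u div 3 ^ (j + i) \<in> {l i, r i}" if "\<bar>u - p\<bar> < 3 ^ (m + 2)" for u i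
  proof -
    have "q \<le> u div 3 ^ j" unfolding q_def using that by (intro zdiv_mono1) auto
    moreover have "\<bar>u - (p - 3 ^ (m + 2))\<bar> \<le> 1 * 3 ^ j"
      using that by (simp add: j_def power_add)
    then have "\<bar>u div 3 ^ j - q\<bar> \<le> 1" unfolding q_def by (intro abs_div_diff_le) auto
    ultimately have "u div 3 ^ j = q \<or> u div 3 ^ j = q + 1" by linarith
    then show ?thesis by (auto simp: div_power3_add l_def r_def)
  qed
  have p: "p div 3 ^ (j + i) \<in> {l i, r i}" for i by (rule core) simp
  have near: "\<bar>a - p\<bar> < 3 ^ (m + 20)" if "i \<le> 15" "l i - 5 \<le> a div 3 ^ (j + i)" "a div 3 ^ (j + i) \<le> r i + 5" for a i
  proof -
    have "\<bar>a div 3 ^ (j + i) - p div 3 ^ (j + i)\<bar> \<le> 8"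
      using that p[of i] lr[of i] by auto
    then have "\<bar>a - p\<bar> < 3 ^ (j + i + 2)" by (rule near_if_blocks_near)
    also have "\<dots> \<le> 3 ^ (m + 20)" using that(1) by (intro power_increasing) (auto simp: j_def)
    finally show ?thesis .
  qed
  show False
  proof (cases "l 10 = r 10")
    case True
    have eq: "l (10 + i) = r (10 + i)" for i unfolding lr_add True ..
    have fol: "\<exists>u. u div 3 ^ (j + (10 + i)) = r (10 + i) \<and> twins W a u"
      if i: "i \<le> 5" "a \<in> U" and a: "l (10 + i) - 5 \<le> a div 3 ^ (j + (10 + i))" "a div 3 ^ (j + (10 + i)) \<le> r (10 + i) + 5" for a i
    proof -
      obtain u where "\<bar>u - p\<bar> < 3 ^ (m + 2)" "twins W a u"
        using twin[OF i(2) near[OF _ a]] i(1) by auto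
      then show ?thesis using core[of u "10 + i"] eq[of i] by auto
    qed
    show False
    \<comment> \<open>The radius needed at this starting level is \<open>3 ^ (j + 17)\<close>, which
      is \<open>3 ^ (m + 20)\<close>.\<close>
    proof (rule follow_contradiction[where U = U and W = W and t = "j + 10" and l = "l 10" and r = "r 10" and p = p])
      show "\<exists>u. u div 3 ^ (j + 10 + i) = r 10 div 3 ^ i \<and> twins W a u"
        if "i \<le> 5" "a \<in> U" "r 10 div 3 ^ i < a div 3 ^ (j + 10 + i)" "a div 3 ^ (j + 10 + i) \<le> r 10 div 3 ^ i + 5" for a i
        using fol[of i a] that eq[of i] by (simp add: lr_add add.assoc)
      show "\<exists>u. u div 3 ^ (j + 10 + i) = l 10 div 3 ^ i \<and> twins W a u"
        if "i \<le> 5" "a \<in> U" "a div 3 ^ (j + 10 + i) < l 10 div 3 ^ i" "l 10 div 3 ^ i - 5 \<le> a div 3 ^ (j + 10 + i)" for a i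
        using fol[of i a] that eq[of i] by (simp add: lr_add add.assoc)
      show "y \<in> U \<union> W" if "\<bar>y - p\<bar> < 3 ^ (j + 10 + 7)" for y
        using cover[of y] that by (simp add: j_def add.assoc)
    qed (use True p[of 10] disj densU densW in \<open>auto simp: j_def\<close>)
  next
    case False
    \<comment> \<open>Here \<open>p\<close> lies next to a boundary that is a block boundary on all levels \<open>j, \<dots>, j + 10\<close>.\<close>
    have "3 ^ 10 dvd q + 1" by (rule dvd_if_div_succ_neq) (use False in \<open>auto simp: l_def r_def\<close>)
    then obtain c where c: "q + 1 = c * 3 ^ 10" by (metis dvd_div_mult_self)
    have r: "r i = c * 3 ^ (10 - i)" "l i = r i - 1" if "i \<le> 10" for i
    proof -
      have "q + 1 = c * 3 ^ (10 - i) * 3 ^ i" using that unfolding c by (simp flip: power_add)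
      then show "r i = c * 3 ^ (10 - i)" by (simp add: r_def)
      have "l i \<noteq> r i"
      proof
        assume "l i = r i"
        then have "l (i + (10 - i)) = r (i + (10 - i))" by (simp only: lr_add)
        then show False using False that by simp
      qed
      then show "l i = r i - 1" using lr[of i] by auto
    qed
    \<comment> \<open>No vertex of \<open>U\<close> follows the block on the other side of that boundary.\<close>
    have same: "u div 3 ^ (j + 7) = a div 3 ^ (j + 7)"
      if a: "a \<in> U" "a div 3 ^ (j + 7) \<in> {l 7, r 7}" and u: "\<bar>u - p\<bar> < 3 ^ (m + 2)" "twins W a u" for a u
    proof (rule ccontr)
      assume neq: "u div 3 ^ (j + 7) \<noteq> a div 3 ^ (j + 7)"
      have a': "a div 3 ^ (j + (7 + i)) \<in> {l (7 + i), r (7 + i)}" for i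
        unfolding lr_add add.assoc[symmetric] div_power3_add[of a "j + 7"] using a(2) by auto
      have neq': "a div 3 ^ (j + (7 + i)) \<noteq> u div 3 ^ (j + (7 + i))" if "i \<le> 3" for i
      proof -
        have "l 7 div 3 ^ i \<noteq> r 7 div 3 ^ i" using r(2)[of "7 + i"] that by (simp add: lr_add)
        moreover have "{a div 3 ^ (j + 7), u div 3 ^ (j + 7)} = {l 7, r 7}"
          using a(2) core[OF u(1), of 7] neq by auto
        ultimately show ?thesis
          unfolding add.assoc[symmetric] div_power3_add[of _ "j + 7"] by (metis doubleton_eq_iff)
      qed
      \<comment> \<open>Twins in different blocks on level \<open>j + 7\<close> remain separated up
        to level \<open>j + 10\<close>. This yields flanks on the four levels used by
        \<open>flanks_in_contradiction\<close>.\<close>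
      have g: "flanks_in U (j + (7 + i)) (l (7 + i)) (l (7 + i) + 1)" if i: "i \<le> 3" for i
      proof (rule flanks_in_split)
        have r1: "r (7 + i) = l (7 + i) + 1" using r(2)[of "7 + i"] i by simp
        show "a div 3 ^ (j + (7 + i)) \<in> {l (7 + i), l (7 + i) + 1}" using a'[of i] r1 by simp
        show "u div 3 ^ (j + (7 + i)) \<in> {l (7 + i), l (7 + i) + 1}" using core[OF u(1), of "7 + i"] r1 by simp
        show "y \<in> U \<union> W" if "l (7 + i) - 5 \<le> y div 3 ^ (j + (7 + i))" "y div 3 ^ (j + (7 + i)) \<le> l (7 + i) + 6" for y
          by (rule cover, rule near[of "7 + i"]) (use that r1 i in auto)
        show "\<exists>v. v div 3 ^ (j + (7 + i)) \<in> {l (7 + i), l (7 + i) + 1} \<and> twins W b v"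
          if b: "b \<in> U" "l (7 + i) - 5 \<le> b div 3 ^ (j + (7 + i))" "b div 3 ^ (j + (7 + i)) \<le> l (7 + i) + 6" for b
        proof -
          have "\<bar>b - p\<bar> < 3 ^ (m + 20)" by (rule near[of "7 + i"]) (use b r1 i in auto)
          then obtain v where v: "\<bar>v - p\<bar> < 3 ^ (m + 2)" "twins W b v" using twin[OF b(1)] by blast
          then show ?thesis using core[OF v(1), of "7 + i"] r1 by auto
        qed
      qed (use neq'[OF i] u(2) in \<open>auto simp: j_def\<close>)
      show False
      proof (rule flanks_in_contradiction)
        show "flanks_in U (j + 7 + i) (l 7 div 3 ^ i) (r 7 div 3 ^ i)" if "i \<le> 3" for i
          using g[OF that] r(2)[of "7 + i"] that by (simp add: lr_add add.assoc)
        show "3 ^ (j + 7 + 3) \<le> 3 * card (W \<inter> {p - 3 ^ (j + 7 + 3)<..<p + 3 ^ (j + 7 + 3)})"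
          by (rule densW) (auto simp: j_def)
      qed (use lr[of 7] p[of 7] disj in auto)
    qed
    \<comment> \<open>The twin lies in \<open>l i\<close> or \<open>r i\<close>, and these have
      different ancestors on level \<open>j + 7\<close>, where \<open>same\<close> ties the twin to
      the ancestor of \<open>a\<close>.\<close>
    have fol: "\<exists>u. u div 3 ^ (j + i) = b \<and> twins W a u" if i: "i \<le> 5" and a: "a \<in> U"
      "a div 3 ^ (j + 7) = b div 3 ^ (7 - i)" "b \<in> {l i, r i}" "\<bar>a - p\<bar> < 3 ^ (m + 20)" for a b i
    proof -
      obtain u where u: "\<bar>u - p\<bar> < 3 ^ (m + 2)" "twins W a u" using twin[OF a(1,4)] by blast
      have 7: "l 7 = l i div 3 ^ (7 - i)" "r 7 = r i div 3 ^ (7 - i)"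
        using lr_add[of i "7 - i"] i by simp_all
      have "u div 3 ^ (j + 7) = a div 3 ^ (j + 7)"
        by (rule same[OF a(1) _ u]) (use a(2,3) 7 in auto)
      then have "u div 3 ^ (j + i) div 3 ^ (7 - i) = b div 3 ^ (7 - i)"
        using i a(2) by (simp flip: div_power3_add)
      moreover have "l i div 3 ^ (7 - i) \<noteq> r i div 3 ^ (7 - i)"
        using r(2)[of 7] 7 by simp
      ultimately have "u div 3 ^ (j + i) = b" using core[OF u(1), of i] a(3) by auto
      then show ?thesis using u(2) by blast
    qed
    have div7: "a div 3 ^ (j + 7) = a div 3 ^ (j + i) div 3 ^ (7 - i)" if "i \<le> 5" for a :: int and i
      using that by (simp flip: div_power3_add)
    have r7: "r i = c * 3 ^ 3 * 3 ^ (7 - i)" if "i \<le> 5" for i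
    proof -
      have "10 - i = 3 + (7 - i)" using that by simp
      then show ?thesis using r(1)[of i] that by (simp only: power_add)
    qed
    \<comment> \<open>Since 9 exceeds 5, the core block on either side of the boundary and the five
      blocks beyond it lie in one block of level \<open>j + 7\<close>. The levels \<open>j\<close>
      to \<open>j + 5\<close> are thus within reach of \<open>fol\<close>.\<close>
    have nine: "(9::int) \<le> 3 ^ (7 - i)" if "i \<le> 5" for i
      using power_increasing[of 2 "7 - i" "3::int"] that by simp
    show False
    proof (rule follow_contradiction[where U = U and W = W and t = j and l = "l 0" and r = "r 0" and p = p])
      show "\<exists>u. u div 3 ^ (j + i) = r 0 div 3 ^ i \<and> twins W a u"
        if "i \<le> 5" "a \<in> U" "r 0 div 3 ^ i < a div 3 ^ (j + i)" "a div 3 ^ (j + i) \<le> r 0 div 3 ^ i + 5" for a i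
      proof (rule fol[OF that(1,2)])
        have r0: "r 0 div 3 ^ i = r i" "l 0 div 3 ^ i = l i" using lr_add[of 0 i] by simp_all
        define e where "e = a div 3 ^ (j + i) - r i"
        have e: "0 \<le> e" "e < 3 ^ (7 - i)" using that(3,4) nine[OF that(1)] unfolding e_def r0 by linarith+
        have "a div 3 ^ (j + i) = e + r i" by (simp add: e_def)
        then show "a div 3 ^ (j + 7) = r 0 div 3 ^ i div 3 ^ (7 - i)"
          unfolding r0 div7[OF that(1)] r7[OF that(1)] using e by (simp add: div_pos_pos_trivial)
        show "\<bar>a - p\<bar> < 3 ^ (m + 20)"
          by (rule near[of i]) (use that lr[of i] r0 in auto)
      qed (use lr_add[of 0 i] in simp)
      show "\<exists>u. u div 3 ^ (j + i) = l 0 div 3 ^ i \<and> twins W a u"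
        if "i \<le> 5" "a \<in> U" "a div 3 ^ (j + i) < l 0 div 3 ^ i" "l 0 div 3 ^ i - 5 \<le> a div 3 ^ (j + i)" for a i
      proof (rule fol[OF that(1,2)])
        have r0: "r 0 div 3 ^ i = r i" "l 0 div 3 ^ i = l i" using lr_add[of 0 i] by simp_all
        have li: "l i = 3 ^ (7 - i) - 1 + (c * 3 ^ 3 - 1) * 3 ^ (7 - i)"
          using r(2)[of i] r7[OF that(1)] that(1) by (simp add: algebra_simps)
        define e where "e = a div 3 ^ (j + i) - (l i - (3 ^ (7 - i) - 1))"
        have e: "0 \<le> e" "e < 3 ^ (7 - i)" using that(3,4) nine[OF that(1)] unfolding e_def r0 by linarith+
        have "a div 3 ^ (j + i) = e + (c * 3 ^ 3 - 1) * 3 ^ (7 - i)" unfolding e_def li by simp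
        then have "a div 3 ^ (j + i) div 3 ^ (7 - i) = c * 3 ^ 3 - 1"
          using e by (simp add: div_pos_pos_trivial del: mult_minus_left)
        moreover have "l i div 3 ^ (7 - i) = c * 3 ^ 3 - 1"
          unfolding li by (subst div_mult_self1) (simp_all add: div_pos_pos_trivial)
        ultimately show "a div 3 ^ (j + 7) = l 0 div 3 ^ i div 3 ^ (7 - i)"
          unfolding r0 div7[OF that(1)] by simp
        show "\<bar>a - p\<bar> < 3 ^ (m + 20)"
          by (rule near[of i]) (use that lr[of i] r0 in auto)
      qed (use lr_add[of 0 i] in simp)
      show "y \<in> U \<union> W" if "\<bar>y - p\<bar> < 3 ^ (j + 7)" for y
      proof (rule cover)
        have "(3::int) ^ (j + 7) \<le> 3 ^ (m + 20)" by (intro power_increasing) (auto simp: j_def)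
        then show "\<bar>y - p\<bar> < 3 ^ (m + 20)" using that by linarith
      qed
    qed (use lr[of 0] p[of 0] disj densU densW in \<open>auto simp: j_def\<close>)
  qed
qed

subsection \<open>Balanced positions\<close>

lemma card_interval_step:
  fixes U :: "int set"
  shows "\<bar>int (card (U \<inter> {s + 1..<s + 1 + d})) - int (card (U \<inter> {s..<s + d}))\<bar> \<le> 1"
proof (cases "d > 0")
  case True
  define M where "M = U \<inter> {s + 1..<s + d}"
  have "finite M" by (simp add: M_def)
  have "U \<inter> {s + 1..<s + 1 + d} = M \<union> (U \<inter> {s + d})" "U \<inter> {s..<s + d} = M \<union> (U \<inter> {s})"
    using True by (auto simp: M_def)
  moreover have "card (M \<union> (U \<inter> {x})) \<in> {card M, Suc (card M)}" for x
    using \<open>finite M\<close> by (cases "x \<in> U") (auto simp: card_insert_if)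
  ultimately show ?thesis by (smt (verit) insert_iff empty_iff of_nat_Suc)
qed simp

text \<open>The three thirds have average density between 1/3 and 2/3. Either one of them is
  balanced, or one has density at most 1/3 and another at least 1/3. In the latter case sliding the
  window changes its count by at most one per move, so the density is exactly 1/3 somewhere.\<close>

lemma ex_balanced_subinterval:
  fixes U :: "int set"
  assumes n: "n \<ge> 1"
    and low: "3 ^ Suc n \<le> 3 * card (U \<inter> {s..<s + 3 ^ Suc n})"
    and high: "3 * card (U \<inter> {s..<s + 3 ^ Suc n}) \<le> 2 * 3 ^ Suc n"
  shows "\<exists>s'. {s'..<s' + 3 ^ n} \<subseteq> {s..<s + 3 ^ Suc n} \<and>
    3 ^ n \<le> 3 * card (U \<inter> {s'..<s' + 3 ^ n}) \<and> 3 * card (U \<inter> {s'..<s' + 3 ^ n}) \<le> 2 * 3 ^ n"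
proof -
  define N :: nat where "N = 3 ^ n"
  define f where "f i = int (card (U \<inter> {s + int i..<s + int i + 3 ^ n}))" for i :: nat
  have N: "int N = 3 ^ n" by (simp add: N_def)
  \<comment> \<open>For \<open>n \<ge> 1\<close> the target \<open>N / 3\<close> is an integer and
    can be hit exactly.\<close>
  have "n = Suc (n - 1)" using n by simp
  then obtain k where k: "N = 3 * k" unfolding N_def by (metis power_Suc)
  have sub: ?thesis if i: "i \<le> 2 * N" and f: "3 * f i \<ge> 3 ^ n" "3 * f i \<le> 2 * 3 ^ n" for i
  proof (intro exI[of _ "s + int i"] conjI)
    have "int i \<le> 2 * 3 ^ n" using i N by linarith
    then show "{s + int i..<s + int i + 3 ^ n} \<subseteq> {s..<s + 3 ^ Suc n}"
      by auto
    have "int (3 * card (U \<inter> {s + int i..<s + int i + 3 ^ n})) \<ge> int (3 ^ n)"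
      "int (3 * card (U \<inter> {s + int i..<s + int i + 3 ^ n})) \<le> int (2 * 3 ^ n)"
      using f by (simp_all add: f_def)
    then show "3 ^ n \<le> 3 * card (U \<inter> {s + int i..<s + int i + 3 ^ n})"
      "3 * card (U \<inter> {s + int i..<s + int i + 3 ^ n}) \<le> 2 * 3 ^ n"
      by (simp_all only: of_nat_le_iff)
  qed
  have step: "\<bar>f (i + 1) - f i\<bar> \<le> 1" for i
    using card_interval_step[of U "s + int i" "3 ^ n"] by (simp add: f_def algebra_simps)
  have total: "f 0 + f N + f (2 * N) = int (card (U \<inter> {s..<s + 3 ^ Suc n}))"
  proof -
    have "U \<inter> {s..<s + 3 ^ Suc n} = (U \<inter> {s..<s + int N}) \<union> (U \<inter> {s + int N..<s + 2 * int N})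
      \<union> (U \<inter> {s + 2 * int N..<s + 3 * int N})"
      using N by auto
    then show ?thesis
      unfolding f_def N[symmetric] by (simp add: card_Un_disjoint disjoint_iff algebra_simps)
  qed
  have low': "3 * (f 0 + f N + f (2 * N)) \<ge> 3 * int N" and high': "3 * (f 0 + f N + f (2 * N)) \<le> 6 * int N"
  proof -
    have "int (3 ^ Suc n) \<le> int (3 * card (U \<inter> {s..<s + 3 ^ Suc n}))" using low by (simp only: of_nat_le_iff)
    then show "3 * (f 0 + f N + f (2 * N)) \<ge> 3 * int N" unfolding total N by simp
    have "int (3 * card (U \<inter> {s..<s + 3 ^ Suc n})) \<le> int (2 * 3 ^ Suc n)" using high by (simp only: of_nat_le_iff)
    then show "3 * (f 0 + f N + f (2 * N)) \<le> 6 * int N" unfolding total N by simp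
  qed
  have cross: ?thesis if ij: "i \<le> 2 * N" "j \<le> 2 * N" and f: "f i \<le> int k" "int k \<le> f j" for i j
  proof -
    have "\<exists>m\<le>2 * N. f m = int k"
    proof (cases "i \<le> j")
      case True
      then have "\<exists>m. i \<le> m \<and> m \<le> j \<and> f m = int k"
        using step f by (intro nat_intermed_int_val) auto
      then show ?thesis using ij by (meson order_trans)
    next
      case False
      then have "\<exists>m. j \<le> m \<and> m \<le> i \<and> - f m = - int k"
        using step f by (intro nat_intermed_int_val[where f = "\<lambda>m. - f m"]) (auto simp: abs_minus_commute)
      then show ?thesis using ij by (metis order_trans neg_equal_iff_equal)
    qed
    then obtain m where "m \<le> 2 * N" "f m = int k" by blast
    then show ?thesis using N k by (intro sub[of m]) auto
  qed
  have kk: "int N = 3 * int k" using k by simp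
  have "f 0 \<le> 2 * int k \<or> f N \<le> 2 * int k \<or> f (2 * N) \<le> 2 * int k"
    using high' kk by arith
  moreover have "f 0 \<ge> int k \<or> f N \<ge> int k \<or> f (2 * N) \<ge> int k"
    using low' kk by arith
  moreover have "0 \<le> 2 * N" "N \<le> 2 * N" "2 * N \<le> 2 * N" by auto
  moreover have ?thesis if "i \<le> 2 * N" "f i \<ge> int k" "f i \<le> 2 * int k" for i
    by (rule sub[of i]) (use that N kk in auto)
  moreover have "int k \<le> f i \<or> f i \<le> int k" for i by (rule linear)
  ultimately show ?thesis using cross by metis
qed

text \<open>Nested balanced intervals are chosen down to length 3, and \<open>p\<close> is taken in
  the innermost. The window of radius \<open>3 ^ t\<close> around \<open>p\<close> contains the
  whole nested interval of length \<open>3 ^ t\<close>.\<close>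

lemma ex_balanced_centre:
  fixes U :: "int set"
  assumes "3 ^ n \<le> 3 * card (U \<inter> {s..<s + 3 ^ n})" "3 * card (U \<inter> {s..<s + 3 ^ n}) \<le> 2 * 3 ^ n"
  shows "\<exists>p\<in>{s..<s + 3 ^ n}. \<forall>t. 1 \<le> t \<longrightarrow> t \<le> n \<longrightarrow>
    3 ^ t \<le> 3 * card (U \<inter> {p - 3 ^ t<..<p + 3 ^ t}) \<and>
    3 ^ t \<le> 3 * card (({s..<s + 3 ^ n} - U) \<inter> {p - 3 ^ t<..<p + 3 ^ t})"
  using assms
proof (induction n arbitrary: s)
  case 0
  then show ?case by auto
next
  case (Suc n)
  let ?Z = "{s..<s + 3 ^ Suc n}"
  have top: "3 ^ Suc n \<le> 3 * card (U \<inter> {p - 3 ^ Suc n<..<p + 3 ^ Suc n}) \<and>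
    3 ^ Suc n \<le> 3 * card ((?Z - U) \<inter> {p - 3 ^ Suc n<..<p + 3 ^ Suc n})" if p: "p \<in> ?Z" for p
  proof
    have sub: "?Z \<subseteq> {p - 3 ^ Suc n<..<p + 3 ^ Suc n}" using p by auto
    then have "card (U \<inter> ?Z) \<le> card (U \<inter> {p - 3 ^ Suc n<..<p + 3 ^ Suc n})"
      by (intro card_mono) auto
    then show "3 ^ Suc n \<le> 3 * card (U \<inter> {p - 3 ^ Suc n<..<p + 3 ^ Suc n})"
      using Suc.prems(1) by linarith
    have "card ?Z = card (U \<inter> ?Z) + card (?Z - U)"
      using card_Int_Diff[of ?Z U] by (simp add: Int_commute)
    moreover have "card ?Z = 3 ^ Suc n" by (simp add: nat_power_eq nat_mult_distrib)
    moreover have "card ((?Z - U) \<inter> {p - 3 ^ Suc n<..<p + 3 ^ Suc n}) = card (?Z - U)"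
      using sub by (intro arg_cong[of _ _ card]) blast
    ultimately show "3 ^ Suc n \<le> 3 * card ((?Z - U) \<inter> {p - 3 ^ Suc n<..<p + 3 ^ Suc n})"
      using Suc.prems(2) by linarith
  qed
  show ?case
  proof (cases "n = 0")
    case True
    show ?thesis
    proof (intro bexI[of _ s] allI impI)
      fix t assume "1 \<le> t" "t \<le> Suc n"
      then have "t = Suc n" using True by simp
      then show "3 ^ t \<le> 3 * card (U \<inter> {s - 3 ^ t<..<s + 3 ^ t}) \<and>
        3 ^ t \<le> 3 * card ((?Z - U) \<inter> {s - 3 ^ t<..<s + 3 ^ t})" using top[of s] by simp
    qed auto
  next
    case False
    then obtain s' where s': "{s'..<s' + 3 ^ n} \<subseteq> ?Z"
      "3 ^ n \<le> 3 * card (U \<inter> {s'..<s' + 3 ^ n})" "3 * card (U \<inter> {s'..<s' + 3 ^ n}) \<le> 2 * 3 ^ n"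
      using ex_balanced_subinterval[OF _ Suc.prems] by auto
    obtain p where p: "p \<in> {s'..<s' + 3 ^ n}" and IH: "\<And>t. 1 \<le> t \<Longrightarrow> t \<le> n \<Longrightarrow>
      3 ^ t \<le> 3 * card (U \<inter> {p - 3 ^ t<..<p + 3 ^ t}) \<and>
      3 ^ t \<le> 3 * card (({s'..<s' + 3 ^ n} - U) \<inter> {p - 3 ^ t<..<p + 3 ^ t})"
      using Suc.IH[OF s'(2,3)] by blast
    show ?thesis
    proof (intro bexI[of _ p] allI impI)
      show "p \<in> ?Z" using p s'(1) by blast
      fix t assume t: "1 \<le> t" "t \<le> Suc n"
      show "3 ^ t \<le> 3 * card (U \<inter> {p - 3 ^ t<..<p + 3 ^ t}) \<and>
        3 ^ t \<le> 3 * card ((?Z - U) \<inter> {p - 3 ^ t<..<p + 3 ^ t})"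
      proof (cases "t = Suc n")
        case True
        then show ?thesis using top[OF \<open>p \<in> ?Z\<close>] by simp
      next
        case False
        have "card (({s'..<s' + 3 ^ n} - U) \<inter> {p - 3 ^ t<..<p + 3 ^ t}) \<le> card ((?Z - U) \<inter> {p - 3 ^ t<..<p + 3 ^ t})"
          using s'(1) by (intro card_mono) auto
        then show ?thesis using IH[of t] t False by linarith
      qed
    qed
  qed
qed

definition link_nbrs :: "int set \<Rightarrow> int \<Rightarrow> int set" where
  "link_nbrs W u = {w \<in> W. leaf_link u w}"

lemma twins_if_link_nbrs_eq: "link_nbrs W a = link_nbrs W u \<Longrightarrow> twins W a u"
  by (auto simp: link_nbrs_def twins_def set_eq_iff)

text \<open>By \<open>not_all_twins_near\<close> the number of types seen around a balanced
  \<open>p\<close> grows with every 18 levels. Placing \<open>p\<close> in the middle third keeps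
  all windows of radius at most \<open>3 ^ (h - 1)\<close> inside the leaf range.\<close>

lemma height_le_card_link_nbrs:
  fixes U W :: "int set"
  assumes h: "h \<ge> 1" and disj: "U \<inter> W = {}" and un: "U \<union> W = {0..<3 ^ h}"
    and low: "3 ^ (h - 1) \<le> 3 * card (U \<inter> {3 ^ (h - 1)..<2 * 3 ^ (h - 1)})"
    and high: "3 * card (U \<inter> {3 ^ (h - 1)..<2 * 3 ^ (h - 1)}) \<le> 2 * 3 ^ (h - 1)"
  shows "h \<le> 18 * card (link_nbrs W ` U) + 20"
proof -
  let ?Z = "{3 ^ (h - 1)..<2 * 3 ^ (h - 1)} :: int set"
  have h3: "(3::int) ^ h = 3 * 3 ^ (h - 1)" using h by (simp flip: power_Suc)
  have Z: "?Z = {3 ^ (h - 1)..<3 ^ (h - 1) + 3 ^ (h - 1)}" by simp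
  obtain p where p: "p \<in> ?Z" and dens: "\<And>t. 1 \<le> t \<Longrightarrow> t \<le> h - 1 \<Longrightarrow>
    3 ^ t \<le> 3 * card (U \<inter> {p - 3 ^ t<..<p + 3 ^ t}) \<and>
    3 ^ t \<le> 3 * card ((?Z - U) \<inter> {p - 3 ^ t<..<p + 3 ^ t})"
    using ex_balanced_centre[of "h - 1" U "3 ^ (h - 1)"] low high unfolding Z by blast
  have "?Z \<subseteq> U \<union> W" unfolding un h3 by auto
  then have densW: "3 ^ t \<le> 3 * card (W \<inter> {p - 3 ^ t<..<p + 3 ^ t})" if "1 \<le> t" "t \<le> h - 1" for t
  proof -
    have "card ((?Z - U) \<inter> {p - 3 ^ t<..<p + 3 ^ t}) \<le> card (W \<inter> {p - 3 ^ t<..<p + 3 ^ t})"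
      using \<open>?Z \<subseteq> U \<union> W\<close> by (intro card_mono) auto
    then show ?thesis using dens[OF that] by linarith
  qed
  define T where "T m = link_nbrs W ` {a \<in> U. \<bar>a - p\<bar> < 3 ^ (m + 2)}" for m :: nat
  have finU: "finite U" using un by (metis finite_Un finite_atLeastLessThan_int)
  then have finT: "finite (T m)" for m by (simp add: T_def)
  have less: "T m \<subset> T (m + 18)" if m: "m + 20 \<le> h - 1" for m
  proof -
    have "(3::int) ^ (m + 2) \<le> 3 ^ (m + 18 + 2)" by (intro power_increasing) auto
    then have sub: "T m \<subseteq> T (m + 18)" unfolding T_def by (intro image_mono) force
    have "T m \<noteq> T (m + 18)"
    proof
      assume eq: "T m = T (m + 18)"
      show False
      proof (rule not_all_twins_near[OF disj])
        show "y \<in> U \<union> W" if "\<bar>y - p\<bar> < 3 ^ (m + 20)" for y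
        proof -
          have "(3::int) ^ (m + 20) \<le> 3 ^ (h - 1)" using m by (intro power_increasing) auto
          moreover have "3 ^ (h - 1) \<le> p" "p < 2 * 3 ^ (h - 1)" using p by auto
          ultimately have "0 \<le> y \<and> y < 3 * 3 ^ (h - 1)" using that by linarith
          then show ?thesis unfolding un h3 by simp
        qed
        show "\<exists>u\<in>U. \<bar>u - p\<bar> < 3 ^ (m + 2) \<and> twins W a u" if "a \<in> U" "\<bar>a - p\<bar> < 3 ^ (m + 20)" for a
        proof -
          have "link_nbrs W a \<in> T (m + 18)" using that by (auto simp: T_def ac_simps)
          then have "link_nbrs W a \<in> T m" using eq by simp
          then show ?thesis unfolding T_def by (auto intro: twins_if_link_nbrs_eq)
        qed
      qed (use dens densW m in auto)
    qed
    then show ?thesis using sub by blast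
  qed
  have "i \<le> card (T (18 * i))" if "18 * i + 2 \<le> h - 1" for i
    using that
  proof (induction i)
    case (Suc i)
    then have "card (T (18 * i)) < card (T (18 * i + 18))"
      by (intro psubset_card_mono finT less) auto
    then show ?case using Suc by (simp add: algebra_simps)
  qed simp
  moreover have "card (T m) \<le> card (link_nbrs W ` U)" for m
    unfolding T_def using finU by (intro card_mono) auto
  ultimately have *: "i \<le> card (link_nbrs W ` U)" if "18 * i + 2 \<le> h - 1" for i
    using that order_trans by blast
  show ?thesis
  proof (cases "h \<ge> 3")
    case True
    \<comment> \<open>The constant 20 is the offset 3 plus the largest remainder 17.\<close>
    then have "(h - 3) div 18 \<le> card (link_nbrs W ` U)" by (intro *) auto
    then show ?thesis by linarith
  qed simp
qed

subsection \<open>Balanced cuts from partition sequences\<close>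

lemma inhomogeneous_sym: "inhomogeneous G X Y \<longleftrightarrow> inhomogeneous G Y X"
proof -
  have "inhomogeneous G Y X" if h: "inhomogeneous G X Y" for X Y
  proof -
    obtain u v u' v' where "u \<in> X" "v \<in> Y" "{u, v} \<in> edges G" "u' \<in> X" "v' \<in> Y" "{u', v'} \<notin> edges G"
      using h unfolding inhomogeneous_def by (elim conjE bexE)
    then show ?thesis
      unfolding inhomogeneous_def by (intro conjI bexI[of _ v] bexI[of _ u] bexI[of _ v'] bexI[of _ u'])
        (simp_all add: insert_commute)
  qed
  then show ?thesis by blast
qed

lemma inhomogeneous_mono:
  assumes "inhomogeneous G X Y" "X \<subseteq> X'" "Y \<subseteq> Y'"
  shows "inhomogeneous G X' Y'"
proof -
  obtain u v u' v' where "u \<in> X" "v \<in> Y" "{u, v} \<in> edges G" "u' \<in> X" "v' \<in> Y" "{u', v'} \<notin> edges G"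
    using assms(1) unfolding inhomogeneous_def by (elim conjE bexE)
  then show ?thesis
    unfolding inhomogeneous_def using assms(2,3) by (intro conjI bexI) auto
qed

lemma adj_rel_red_graph:
  "adj_rel (red_graph G P) = {(X, Y). X \<in> P \<and> Y \<in> P \<and> X \<noteq> Y \<and> inhomogeneous G X Y}"
proof -
  have "{X, Y} \<in> edges (red_graph G P) \<longleftrightarrow> X \<in> P \<and> Y \<in> P \<and> X \<noteq> Y \<and> inhomogeneous G X Y" for X Y
    using inhomogeneous_sym[of G X Y] by (auto simp: red_graph_def doubleton_eq_iff)
  then show ?thesis unfolding adj_rel_def by (auto simp: red_graph_def)
qed

definition red_comp :: "'a graph \<Rightarrow> 'a set set \<Rightarrow> 'a set \<Rightarrow> 'a set set" where
  "red_comp G P X = {Y \<in> P. (X, Y) \<in> (adj_rel (red_graph G P))\<^sup>*}"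

lemma card_red_comp_le:
  assumes "finite P" "X \<in> P"
  shows "card (red_comp G P X) \<le> largest_component (red_graph G P)"
proof -
  have "components (red_graph G P) = red_comp G P ` P"
    by (auto simp: components_def red_comp_def red_graph_def)
  then show ?thesis
    unfolding largest_component_def using assms by (intro Max_ge) auto
qed

lemma red_comp_closed:
  assumes "Y \<in> red_comp G P X" "Z \<in> P" "Y \<noteq> Z" "inhomogeneous G Y Z"
  shows "Z \<in> red_comp G P X"
proof -
  have "(Y, Z) \<in> adj_rel (red_graph G P)" "(X, Y) \<in> (adj_rel (red_graph G P))\<^sup>*"
    using assms by (auto simp: red_comp_def adj_rel_red_graph)
  then show ?thesis using assms(2) by (simp add: red_comp_def)
qed

lemma red_comp_subset:
  assumes "X \<in> S" and closed: "\<And>Y Z. Y \<in> S \<Longrightarrow> Z \<in> P \<Longrightarrow> Y \<noteq> Z \<Longrightarrow> inhomogeneous G Y Z \<Longrightarrow> Z \<in> S"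
  shows "red_comp G P X \<subseteq> S"
proof
  fix Y assume "Y \<in> red_comp G P X"
  then have "(X, Y) \<in> (adj_rel (red_graph G P))\<^sup>*" by (simp add: red_comp_def)
  then show "Y \<in> S"
    by induction (use assms(1) closed in \<open>auto simp: adj_rel_red_graph\<close>)
qed

lemma ex_last_step:
  fixes n :: nat
  assumes "Q 1" "\<not> Q n" "1 \<le> n"
  shows "\<exists>i\<in>{1..<n}. Q i \<and> \<not> Q (Suc i)"
proof (rule ccontr)
  assume c: "\<not> ?thesis"
  have "i \<le> n \<longrightarrow> Q i" if "1 \<le> i" for i
    using that by (induction i rule: dec_induct) (use assms(1) c in auto)
  then show False using assms by blast
qed

text \<open>A closed family that is minimal among those of weight at least \<open>a\<close> loses less than \<open>a\<close> when
  one red component is removed, which bounds its weight by \<open>2 * a\<close>.\<close>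

lemma ex_closed_balanced:
  fixes Z :: "'a set"
  assumes fin: "finite C" "finite Z" and CP: "C \<subseteq> P"
    and closed: "\<And>X Y. X \<in> C \<Longrightarrow> Y \<in> P \<Longrightarrow> X \<noteq> Y \<Longrightarrow> inhomogeneous G X Y \<Longrightarrow> Y \<in> C"
    and small: "\<And>X. X \<in> P \<Longrightarrow> card (\<Union>(red_comp G P X) \<inter> Z) < a"
    and big: "a \<le> card (\<Union>C \<inter> Z)" and a: "a > 0"
  shows "\<exists>S\<subseteq>C. (\<forall>X\<in>S. \<forall>Y\<in>P. X \<noteq> Y \<longrightarrow> inhomogeneous G X Y \<longrightarrow> Y \<in> S) \<and>
    a \<le> card (\<Union>S \<inter> Z) \<and> card (\<Union>S \<inter> Z) < 2 * a"
proof -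
  define Q where "Q S \<longleftrightarrow> S \<subseteq> C \<and> (\<forall>X\<in>S. \<forall>Y\<in>P. X \<noteq> Y \<longrightarrow> inhomogeneous G X Y \<longrightarrow> Y \<in> S) \<and>
    a \<le> card (\<Union>S \<inter> Z)" for S
  have "Q C" unfolding Q_def using closed big by blast
  then obtain S where S: "Q S" and min: "\<And>S'. Q S' \<Longrightarrow> card S \<le> card S'"
    using ex_has_least_nat[of Q C card] by blast
  have SC: "S \<subseteq> C" and Scl: "\<And>X Y. X \<in> S \<Longrightarrow> Y \<in> P \<Longrightarrow> X \<noteq> Y \<Longrightarrow> inhomogeneous G X Y \<Longrightarrow> Y \<in> S"
    and Sa: "a \<le> card (\<Union>S \<inter> Z)" using S unfolding Q_def by blast+
  have finS: "finite S" using SC fin(1) finite_subset by blast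
  have "S \<noteq> {}" using Sa a by auto
  then obtain X where X: "X \<in> S" by blast
  define K where "K = red_comp G P X"
  have KS: "K \<subseteq> S" unfolding K_def by (rule red_comp_subset[OF X Scl])
  have "X \<in> K" using X SC CP by (auto simp: K_def red_comp_def)
  have "\<not> Q (S - K)"
  proof
    assume "Q (S - K)"
    then have "card S \<le> card (S - K)" by (rule min)
    moreover have "card (S - K) < card S"
      using finS X \<open>X \<in> K\<close> by (intro psubset_card_mono) auto
    ultimately show False by simp
  qed
  moreover have "Y \<in> S - K" if "X' \<in> S - K" "Y \<in> P" "X' \<noteq> Y" "inhomogeneous G X' Y" for X' Y
  proof -
    have "Y \<notin> K"
    proof
      assume "Y \<in> K"
      then have "X' \<in> K" unfolding K_def
        by (rule red_comp_closed) (use that SC CP inhomogeneous_sym[of G X' Y] in auto)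
      then show False using that(1) by blast
    qed
    then show ?thesis using Scl that by blast
  qed
  ultimately have "card (\<Union>(S - K) \<inter> Z) < a"
    using SC unfolding Q_def by (meson Diff_subset not_le order_trans)
  moreover have "card (\<Union>K \<inter> Z) < a" unfolding K_def using X SC CP by (intro small) auto
  moreover have "card (\<Union>S \<inter> Z) \<le> card (\<Union>(S - K) \<inter> Z) + card (\<Union>K \<inter> Z)"
  proof -
    have "\<Union>S \<inter> Z = (\<Union>(S - K) \<inter> Z) \<union> (\<Union>K \<inter> Z)" using KS by blast
    then show ?thesis by (simp add: card_Un_le)
  qed
  ultimately show ?thesis using SC Scl Sa by (intro exI[of _ S]) auto
qed

text \<open>A part in a closed family is homogeneous towards each part outside it, so all its
  vertices have the same neighbours outside the union. Each part thus contributes one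
  neighbourhood.\<close>

lemma card_nbhds_le:
  assumes P: "partition_on V P" and S: "S \<subseteq> P" "finite S"
    and closed: "\<And>X Y. X \<in> S \<Longrightarrow> Y \<in> P \<Longrightarrow> X \<noteq> Y \<Longrightarrow> inhomogeneous G X Y \<Longrightarrow> Y \<in> S"
  shows "card ((\<lambda>u. {w \<in> V - \<Union>S. {u, w} \<in> edges G}) ` \<Union>S) \<le> card S"
proof -
  define N where "N u = {w \<in> V - \<Union>S. {u, w} \<in> edges G}" for u
  have same: "N u = N u'" if X: "X \<in> S" "u \<in> X" "u' \<in> X" for X u u'
  proof -
    have "{u, w} \<in> edges G \<longleftrightarrow> {u', w} \<in> edges G" if w: "w \<in> V - \<Union>S" for w
    proof -
      obtain Y where Y: "Y \<in> P" "w \<in> Y" using w P by (auto simp: partition_on_def)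
      then have "Y \<notin> S" using w by blast
      then have "\<not> inhomogeneous G X Y" using closed[OF X(1) Y(1)] X(1) by blast
      then show ?thesis unfolding inhomogeneous_def using X Y by blast
    qed
    then show ?thesis unfolding N_def by blast
  qed
  have "N ` \<Union>S \<subseteq> (\<lambda>X. N (SOME u. u \<in> X)) ` S"
  proof
    fix M assume "M \<in> N ` \<Union>S"
    then obtain X u where X: "X \<in> S" "u \<in> X" "M = N u" by blast
    then have "(SOME u. u \<in> X) \<in> X" by (meson someI)
    then have "M = N (SOME u. u \<in> X)" using same X by blast
    then show "M \<in> (\<lambda>X. N (SOME u. u \<in> X)) ` S" using X by blast
  qed
  then have "card (N ` \<Union>S) \<le> card ((\<lambda>X. N (SOME u. u \<in> X)) ` S)"
    using S(2) by (intro card_mono) auto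
  also have "\<dots> \<le> card S" by (rule card_image_le[OF S(2)])
  finally show ?thesis by (simp add: N_def)
qed

text \<open>At the merge that creates a heavy red component, that component has at most
  \<open>k\<close> parts but possibly too much weight. Undoing the merge gives at most
  \<open>k + 1\<close> parts in a partition whose components are all light, and from these a closed
  family of the right weight can be selected.\<close>

lemma ex_balanced_cut:
  fixes G :: "'a graph"
  assumes fin: "finite (verts G)" and seq: "partition_sequence G \<P>"
    and k: "\<And>i. i \<in> {1..card (verts G)} \<Longrightarrow> largest_component (red_graph G (\<P> i)) \<le> k"
    and Z: "Z \<subseteq> verts G" and a: "1 < a" "a \<le> card Z"
  shows "\<exists>U\<subseteq>verts G. a \<le> card (U \<inter> Z) \<and> card (U \<inter> Z) < 2 * a \<and>
    card ((\<lambda>u. {w \<in> verts G - U. {u, w} \<in> edges G}) ` U) \<le> k + 1"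
proof -
  define V where "V = verts G"
  define n where "n = card V"
  note seq' = seq[unfolded partition_sequence_def, folded V_def, folded n_def]
  have part: "partition_on V (\<P> i)" if "i \<in> {1..n}" for i
    using seq'[THEN conjunct1] that by (rule bspec)
  have Pn: "\<P> n = (\<lambda>v. {v}) ` V" by (rule seq'[THEN conjunct2, THEN conjunct1])
  have P1: "\<P> 1 = {V}" by (rule seq'[THEN conjunct2, THEN conjunct2, THEN conjunct1])
  have merge: "\<exists>X\<in>\<P> (Suc i). \<exists>Y\<in>\<P> (Suc i). X \<noteq> Y \<and> \<P> i = insert (X \<union> Y) (\<P> (Suc i) - {X, Y})"
    if "i \<in> {1..<n}" for i
    using seq'[THEN conjunct2, THEN conjunct2, THEN conjunct2] that by (rule bspec)
  have finV: "finite V" and ZV: "Z \<subseteq> V" using fin Z by (simp_all add: V_def)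
  have finZ: "finite Z" using finV ZV finite_subset by blast
  have "a \<le> n" unfolding n_def using a(2) card_mono[OF finV ZV] by simp
  define Q where "Q i \<longleftrightarrow> (\<exists>X\<in>\<P> i. a \<le> card (\<Union>(red_comp G (\<P> i) X) \<inter> Z))" for i
  have "Q 1"
  proof -
    have "red_comp G {V} V = {V}" by (auto simp: red_comp_def)
    then show ?thesis unfolding Q_def P1 using a(2) ZV by (simp add: Int_absorb1)
  qed
  \<comment> \<open>Singletons are never inhomogeneous, so components of the finest partition weigh
    at most 1, and \<open>a > 1\<close>.\<close>
  moreover have "\<not> Q n"
  proof -
    have "adj_rel (red_graph G (\<P> n)) = {}"
      unfolding adj_rel_red_graph Pn by (auto simp: inhomogeneous_def)
    then have "red_comp G (\<P> n) X \<subseteq> {X}" for X by (auto simp: red_comp_def)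
    then have "\<Union>(red_comp G (\<P> n) {v}) \<inter> Z \<subseteq> {v}" for v by blast
    then have "card (\<Union>(red_comp G (\<P> n) {v}) \<inter> Z) \<le> card {v}" for v by (intro card_mono) auto
    then have "card (\<Union>(red_comp G (\<P> n) {v}) \<inter> Z) < a" for v using a(1) by (metis card.empty card_insert_disjoint empty_iff finite.emptyI le_less_trans One_nat_def)
    then show ?thesis unfolding Q_def Pn by (auto simp: not_le Pn)
  qed
  ultimately obtain i where i: "i \<in> {1..<n}" "Q i" "\<not> Q (Suc i)"
    using ex_last_step[of Q n] \<open>a \<le> n\<close> a(1) by auto
  define P P' where "P = \<P> i" and "P' = \<P> (Suc i)"
  have partP: "partition_on V P" and partP': "partition_on V P'"
    unfolding P_def P'_def using i(1) by (auto intro!: part)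
  obtain X1 Y1 where XY: "X1 \<in> P'" "Y1 \<in> P'" "P = insert (X1 \<union> Y1) (P' - {X1, Y1})"
    using merge[OF i(1)] unfolding P_def P'_def by (elim bexE conjE)
  have finP: "finite P" and finP': "finite P'" using partP partP' finV finite_elements by blast+
  obtain X where X: "X \<in> P" "a \<le> card (\<Union>(red_comp G P X) \<inter> Z)"
    using i(2) unfolding Q_def P_def by blast
  define C where "C = red_comp G P X"
  define C' where "C' = {Y \<in> P'. Y \<subseteq> \<Union>C}"
  have CP: "C \<subseteq> P" by (auto simp: C_def red_comp_def)
  have "card C \<le> k"
    unfolding C_def using card_red_comp_le[OF finP X(1), of G] k[of i] i(1)
    by (simp add: P_def n_def V_def)
  have memP: "A \<in> P \<longleftrightarrow> A = X1 \<union> Y1 \<or> A \<in> P' \<and> A \<noteq> X1 \<and> A \<noteq> Y1" for A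
    by (subst XY(3)) auto
  have refine: "\<exists>X\<in>P. Y \<subseteq> X" if "Y \<in> P'" for Y
  proof (cases "Y \<in> {X1, Y1}")
    case True
    then show ?thesis using memP[of "X1 \<union> Y1"] by auto
  next
    case False
    then show ?thesis using memP[of Y] that by auto
  qed
  have inC: "X' \<in> C" if "Y \<in> C'" "X' \<in> P" "Y \<subseteq> X'" for X' Y
  proof -
    have "Y \<noteq> {}" using that(1) partP' by (auto simp: C'_def partition_on_def)
    then obtain v where v: "v \<in> Y" by blast
    then have "v \<in> \<Union>C" using that(1) by (auto simp only: C'_def mem_Collect_eq)
    then obtain D where D: "D \<in> C" "v \<in> D" by (rule UnionE)
    have "D = X'"
    proof (rule ccontr)
      assume "D \<noteq> X'"
      moreover have "disjoint P" using partP by (simp add: partition_on_def)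
      ultimately have "D \<inter> X' = {}" using D(1) CP that(2) by (intro disjointD[of P]) auto
      then show False using D(2) v that(3) by blast
    qed
    then show ?thesis using D(1) by simp
  qed
  \<comment> \<open>Inhomogeneity passes to supersets, so a red edge before the merge becomes a red
    edge after it or lies inside the merged part.\<close>
  have C'closed: "Y' \<in> C'" if Y: "Y \<in> C'" "Y' \<in> P'" "inhomogeneous G Y Y'" for Y Y'
  proof -
    have "Y \<in> P'" using Y(1) by (simp add: C'_def)
    from refine[OF this] obtain A where A: "A \<in> P" "Y \<subseteq> A" ..
    from refine[OF Y(2)] obtain A' where A': "A' \<in> P" "Y' \<subseteq> A'" ..
    have "A \<in> C" by (rule inC[OF Y(1) A])
    have "A' \<in> C"
    proof (cases "A = A'")
      case False
      have "inhomogeneous G A A'" by (rule inhomogeneous_mono[OF Y(3) A(2) A'(2)])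
      with \<open>A \<in> C\<close> A'(1) False show ?thesis unfolding C_def by (rule red_comp_closed)
    qed (use \<open>A \<in> C\<close> in simp)
    then show ?thesis using Y(2) A'(2) by (auto simp: C'_def)
  qed
  have UC: "\<Union>C' = \<Union>C"
  proof
    show "\<Union>C \<subseteq> \<Union>C'"
    proof
      fix v assume "v \<in> \<Union>C"
      then obtain A where A: "A \<in> C" "v \<in> A" by blast
      then have "A \<in> P" using CP by blast
      then have "A = X1 \<union> Y1 \<or> A \<in> P'" using memP by blast
      then obtain Y where "Y \<in> P'" "v \<in> Y" "Y \<subseteq> A" using XY(1,2) A(2) by auto
      then show "v \<in> \<Union>C'" using A(1) by (auto simp: C'_def)
    qed
  qed (auto simp: C'_def)
  \<comment> \<open>If the merged part belongs to \<open>C\<close>, two parts replace it; otherwise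
    \<open>C\<close> is unaffected by undoing the merge.\<close>
  have "card C' \<le> k + 1"
  proof (cases "X1 \<union> Y1 \<in> C")
    case True
    have "C' \<subseteq> insert X1 (insert Y1 (C - {X1 \<union> Y1}))"
    proof
      fix Y assume Y: "Y \<in> C'"
      show "Y \<in> insert X1 (insert Y1 (C - {X1 \<union> Y1}))"
      proof (cases "Y \<in> {X1, Y1}")
        case False
        then have "Y \<in> P" using Y memP[of Y] by (auto simp: C'_def)
        then have "Y \<in> C" using inC Y by blast
        moreover have "Y \<noteq> X1 \<union> Y1"
        proof
          assume eq: "Y = X1 \<union> Y1"
          have "disjoint P'" "X1 \<noteq> {}" using partP' XY(1) by (auto simp: partition_on_def)
          moreover have "Y \<in> P'" using Y by (simp add: C'_def)
          ultimately have "X1 \<inter> Y = {}" using XY(1) False by (intro disjointD[of P']) auto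
          then show False using eq \<open>X1 \<noteq> {}\<close> by blast
        qed
        ultimately show ?thesis by blast
      qed auto
    qed
    moreover have finC: "finite C" using CP finP finite_subset by blast
    ultimately have "card C' \<le> card (insert X1 (insert Y1 (C - {X1 \<union> Y1})))"
      by (intro card_mono) auto
    also have "\<dots> \<le> Suc (Suc (card (C - {X1 \<union> Y1})))"
      using finC by (auto simp: card_insert_if)
    also have "\<dots> = Suc (card C)" by (simp only: card_Suc_Diff1[OF finC True])
    finally show ?thesis using \<open>card C \<le> k\<close> by simp
  next
    case False
    have "C' \<subseteq> C"
    proof
      fix Y assume Y: "Y \<in> C'"
      have "Y \<in> P"
      proof (rule ccontr)
        assume "Y \<notin> P"
        then have "Y \<subseteq> X1 \<union> Y1" using Y memP[of Y] by (auto simp: C'_def)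
        then show False using inC[OF Y, of "X1 \<union> Y1"] memP[of "X1 \<union> Y1"] False by simp
      qed
      then show "Y \<in> C" using inC Y by blast
    qed
    then have "card C' \<le> card C" using CP finP by (meson card_mono finite_subset)
    then show ?thesis using \<open>card C \<le> k\<close> by simp
  qed
  have finC': "finite C'" using finP' by (simp add: C'_def)
  have "\<exists>S\<subseteq>C'. (\<forall>X\<in>S. \<forall>Y\<in>P'. X \<noteq> Y \<longrightarrow> inhomogeneous G X Y \<longrightarrow> Y \<in> S) \<and>
    a \<le> card (\<Union>S \<inter> Z) \<and> card (\<Union>S \<inter> Z) < 2 * a"
  proof (rule ex_closed_balanced[OF finC' finZ])
    show "C' \<subseteq> P'" by (auto simp: C'_def)
    show "card (\<Union>(red_comp G P' Y) \<inter> Z) < a" if "Y \<in> P'" for Y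
      using i(3) that unfolding Q_def P'_def by (auto simp: not_le)
    show "Y \<in> C'" if "X \<in> C'" "Y \<in> P'" "inhomogeneous G X Y" for X Y
      using that by (rule C'closed)
    show "a \<le> card (\<Union>C' \<inter> Z)" using X(2) by (simp only: UC C_def)
    show "0 < a" using a by simp
  qed
  then obtain S where S: "S \<subseteq> C'"
    and S_closed: "\<forall>X\<in>S. \<forall>Y\<in>P'. X \<noteq> Y \<longrightarrow> inhomogeneous G X Y \<longrightarrow> Y \<in> S"
    and S_card: "a \<le> card (\<Union>S \<inter> Z)" "card (\<Union>S \<inter> Z) < 2 * a"
    by (elim exE conjE)
  have SP: "S \<subseteq> P'" and finS: "finite S" using S finC' by (auto simp: C'_def intro: finite_subset)
  have "card ((\<lambda>u. {w \<in> V - \<Union>S. {u, w} \<in> edges G}) ` \<Union>S) \<le> card S"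
    by (rule card_nbhds_le[OF partP' SP finS]) (rule S_closed[rule_format])
  also have "\<dots> \<le> k + 1" using card_mono[OF finC' S] \<open>card C' \<le> k + 1\<close> by simp
  finally show ?thesis
    unfolding V_def[symmetric]
  proof (intro exI conjI)
    show "\<Union>S \<subseteq> V" using SP partP' by (auto simp: partition_on_def)
  qed (assumption | rule S_card)+
qed

text \<open>Enumerate the vertices and let one growing part absorb them one at a time. This keeps
  the infimum in \<open>ctww\<close> from ranging over the empty set.\<close>

lemma ex_partition_sequence:
  fixes G :: "'a graph"
  assumes fin: "finite (verts G)" and ne: "verts G \<noteq> {}"
  shows "\<exists>\<P>. partition_sequence G \<P>"
proof -
  define V n where "V = verts G" and "n = card V"
  have "n > 0" using assms by (simp add: V_def n_def card_gt_0_iff)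
  obtain f where f: "bij_betw f {..<n} V"
    using ex_bij_betw_nat_finite[OF fin] unfolding V_def n_def atLeast0LessThan by blast
  have img: "f ` {..<n} = V" and inj: "inj_on f {..<n}" using f by (auto simp: bij_betw_def)
  \<comment> \<open>The large part holds \<open>n - i + 1\<close> vertices, leaving
    \<open>i - 1\<close> singletons and hence \<open>i\<close> parts in all.\<close>
  define \<P> where "\<P> i = insert (f ` {..n - i}) ((\<lambda>j. {f j}) ` {n - i<..<n})" for i
  have "partition_on V (\<P> i)" if i: "i \<in> {1..n}" for i
  proof (rule partition_onI)
    have "{..<n} = {..n - i} \<union> {n - i<..<n}" using i by auto
    then show "\<Union>(\<P> i) = V" unfolding img[symmetric] by (auto simp: \<P>_def)
    have d: "f x \<noteq> f y" if "x < n" "y < n" "x \<noteq> y" for x y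
      using inj that by (auto simp: inj_on_def)
    fix p q assume "p \<in> \<P> i" "q \<in> \<P> i" "p \<noteq> q"
    then show "disjnt p q" using d i unfolding \<P>_def disjnt_def by (auto; fastforce)
  qed (auto simp: \<P>_def)
  moreover have "\<P> n = (\<lambda>v. {v}) ` V"
  proof -
    have "{..<n} = insert 0 {0<..<n}" using \<open>n > 0\<close> by auto
    then have "V = insert (f 0) (f ` {0<..<n})" unfolding img[symmetric] by simp
    then show ?thesis by (simp add: \<P>_def image_image)
  qed
  moreover have "\<P> 1 = {V}"
  proof -
    have "{..n - 1} = {..<n}" using \<open>n > 0\<close> by auto
    moreover have "{n - 1<..<n} = {}" by auto
    ultimately show ?thesis by (simp add: \<P>_def img)
  qed
  moreover have "\<exists>X\<in>\<P> (Suc i). \<exists>Y\<in>\<P> (Suc i). X \<noteq> Y \<and> \<P> i = insert (X \<union> Y) (\<P> (Suc i) - {X, Y})"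
    if i: "i \<in> {1..<n}" for i
  proof -
    define m where "m = n - Suc i"
    have m: "n - i = Suc m" "Suc m < n" using i by (auto simp: m_def)
    have d: "f x = f y \<longleftrightarrow> x = y" if "x < n" "y < n" for x y
      using inj that by (auto simp: inj_on_def)
    have P: "\<P> (Suc i) = insert (f ` {..m}) (insert {f (Suc m)} ((\<lambda>j. {f j}) ` {Suc m<..<n}))"
    proof -
      have "{m<..<n} = insert (Suc m) {Suc m<..<n}" using m by auto
      then show ?thesis by (simp add: \<P>_def m_def[symmetric])
    qed
    have P': "\<P> i = insert (f ` {..m} \<union> {f (Suc m)}) ((\<lambda>j. {f j}) ` {Suc m<..<n})"
      by (simp add: \<P>_def m(1) atMost_Suc insert_commute)
    have "f ` {..m} \<noteq> {f (Suc m)}"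
    proof
      assume "f ` {..m} = {f (Suc m)}"
      then have "f 0 = f (Suc m)" by blast
      then show False using d[of 0 "Suc m"] m(2) by simp
    qed
    moreover have "f ` {..m} \<notin> (\<lambda>j. {f j}) ` {Suc m<..<n}"
    proof
      assume "f ` {..m} \<in> (\<lambda>j. {f j}) ` {Suc m<..<n}"
      then obtain j where j: "j \<in> {Suc m<..<n}" "f ` {..m} = {f j}" by blast
      then have "f 0 = f j" by blast
      then show False using d[of 0 j] j(1) by simp
    qed
    moreover have "{f (Suc m)} \<notin> (\<lambda>j. {f j}) ` {Suc m<..<n}"
    proof
      assume "{f (Suc m)} \<in> (\<lambda>j. {f j}) ` {Suc m<..<n}"
      then obtain j where j: "j \<in> {Suc m<..<n}" "f (Suc m) = f j" by blast
      then show False using d[of "Suc m" j] by simp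
    qed
    ultimately show ?thesis unfolding P P'
      by (intro bexI[of _ "f ` {..m}"] bexI[of _ "{f (Suc m)}"]) auto
  qed
  ultimately have "partition_sequence G \<P>"
    unfolding partition_sequence_def V_def[symmetric] n_def[symmetric] by (intro conjI ballI)
  then show ?thesis by blast
qed

lemma ex_partition_sequence_ctww:
  fixes G :: "'a graph"
  assumes "finite (verts G)" "verts G \<noteq> {}"
  shows "\<exists>\<P>. partition_sequence G \<P> \<and>
    (\<forall>i\<in>{1..card (verts G)}. largest_component (red_graph G (\<P> i)) \<le> ctww G)"
proof -
  define width where "width \<P> = (MAX i \<in> {1..card (verts G)}. largest_component (red_graph G (\<P> i)))" for \<P>
  have "ctww G \<in> width ` {\<P>. partition_sequence G \<P>}"
    unfolding ctww_def width_def
    by (rule Inf_nat_def1) (use ex_partition_sequence[OF assms] in auto)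
  then obtain \<P> where "partition_sequence G \<P>" "ctww G = width \<P>" by blast
  moreover have "largest_component (red_graph G (\<P> i)) \<le> width \<P>" if "i \<in> {1..card (verts G)}" for i
    unfolding width_def using that by (intro Max_ge) auto
  ultimately show ?thesis by metis
qed

subsection \<open>Leaves of the ternary tree\<close>

text \<open>Tree positions start at 1. Shifted to start at 0, the children of node \<open>q\<close>
  are \<open>3 * q\<close>, \<open>3 * q + 1\<close>, \<open>3 * q + 2\<close>, so going to the
  parent is division by 3.\<close>

lemma tree_ancestor_leaf_iff:
  assumes x: "x < 3 ^ h"
  shows "tree_ancestor h a (0, Suc x) \<longleftrightarrow> (\<exists>l\<le>h. a = (l, Suc (x div 3 ^ l)))"
proof
  assume "tree_ancestor h a (0, Suc x)"
  then have "(a, (0, Suc x)) \<in> (tree_child h)\<^sup>*" by (simp add: tree_ancestor_def)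
  then show "\<exists>l\<le>h. a = (l, Suc (x div 3 ^ l))"
  proof (induction rule: converse_rtrancl_induct)
    case base
    show ?case by (intro exI[of _ 0]) simp
  next
    case (step a b)
    obtain l where l: "l \<le> h" "b = (l, Suc (x div 3 ^ l))" using step.IH by blast
    obtain i where i: "a = (Suc l, i)" "(Suc l, i) \<in> tree_nodes h"
      "Suc (x div 3 ^ l) \<in> {3 * i - 2, 3 * i - 1, 3 * i}"
      using step.hyps(1) l(2) by (auto simp: tree_child_def)
    have "i \<ge> 1" "Suc l \<le> h" using i(2) by (auto simp: tree_nodes_def)
    then have "i = Suc (x div 3 ^ l div 3)" using i(3) by auto
    then have "a = (Suc l, Suc (x div 3 ^ Suc l))"
      using i(1) by (simp only: power_Suc2 div_mult2_eq)
    then show ?case using \<open>Suc l \<le> h\<close> by blast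
  qed
next
  assume "\<exists>l\<le>h. a = (l, Suc (x div 3 ^ l))"
  then obtain l where "l \<le> h" "a = (l, Suc (x div 3 ^ l))" by blast
  moreover have "((l, Suc (x div 3 ^ l)), (0, Suc x)) \<in> (tree_child h)\<^sup>*" if "l \<le> h" for l
    using that
  proof (induction l)
    case (Suc l)
    have "x < 3 ^ (h - Suc l) * 3 ^ Suc l"
      using x Suc.prems by (simp only: power_add[symmetric] le_add_diff_inverse2)
    then have "x div 3 ^ Suc l < 3 ^ (h - Suc l)" by (rule less_mult_imp_div_less)
    then have "(Suc l, Suc (x div 3 ^ Suc l)) \<in> tree_nodes h"
      using Suc.prems by (simp add: tree_nodes_def)
    moreover have "x div 3 ^ Suc l = x div 3 ^ l div 3" by (simp only: power_Suc2 div_mult2_eq)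
    then have "Suc (x div 3 ^ l) \<in> {3 * Suc (x div 3 ^ Suc l) - 2, 3 * Suc (x div 3 ^ Suc l) - 1, 3 * Suc (x div 3 ^ Suc l)}"
      by auto
    ultimately have "((Suc l, Suc (x div 3 ^ Suc l)), (l, Suc (x div 3 ^ l))) \<in> tree_child h"
      unfolding tree_child_def by blast
    moreover have "((l, Suc (x div 3 ^ l)), (0, Suc x)) \<in> (tree_child h)\<^sup>*"
      using Suc by simp
    ultimately show ?case by (rule converse_rtrancl_into_rtrancl)
  qed simp
  ultimately show "tree_ancestor h a (0, Suc x)" by (simp add: tree_ancestor_def)
qed

text \<open>Meant for nonnegative \<open>x\<close>; \<open>nat\<close> sends negative integers to 0,
  so injectivity is only claimed from 0 on.\<close>

definition leaf :: "int \<Rightarrow> nat \<times> nat" where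
  "leaf x = (0, Suc (nat x))"

lemma inj_on_leaf: "inj_on leaf {0..<n}"
  by (auto simp: inj_on_def leaf_def)

lemma verts_A3: "verts (A3 h) = leaf ` {0..<3 ^ h}"
proof -
  have "(0, i) \<in> leaf ` {0..<3 ^ h}" if "1 \<le> i" "i \<le> 3 ^ h" for i
  proof
    show "(0, i) = leaf (int (i - 1))" using that(1) by (simp add: leaf_def)
    have "int (i - 1) < int (3 ^ h)" using that by (simp only: of_nat_less_iff)
    then show "int (i - 1) \<in> {0..<3 ^ h}" by simp
  qed
  moreover have "nat x < 3 ^ h" if "0 \<le> x" "x < 3 ^ h" for x
    using that by (simp add: nat_less_iff)
  ultimately show ?thesis
    by (auto simp: A3_def tree_leaves_def tree_nodes_def leaf_def Suc_le_eq)
qed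

lemma doubleton_mem_iff: "{p, q} \<in> {{u, v} |u v. R u v} \<longleftrightarrow> R p q \<or> R q p"
  by (auto simp: doubleton_eq_iff)

lemma edge_A3_iff:
  assumes x: "x \<in> {0..<3 ^ h}" and y: "y \<in> {0..<3 ^ h}"
  shows "{leaf x, leaf y} \<in> edges (A3 h) \<longleftrightarrow> leaf_link x y"
proof -
  define m n where "m = nat x" and "n = nat y"
  have xm: "x = int m" "m < 3 ^ h" and yn: "y = int n" "n < 3 ^ h"
    using x y by (auto simp: m_def n_def nat_less_iff)
  have lf: "leaf x = (0, Suc m)" "leaf y = (0, Suc n)" by (simp_all add: leaf_def m_def n_def)
  define E where "E u v \<longleftrightarrow> (\<exists>l. \<exists>a\<in>tree_nodes h. \<exists>b\<in>tree_nodes h.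
           tree_ancestor h a u \<and> tree_ancestor h b v \<and> linked l a b)" for u v
  have node: "(l, Suc (k div 3 ^ l)) \<in> tree_nodes h" if "k < 3 ^ h" "l \<le> h" for k l
  proof -
    have "k < 3 ^ (h - l) * 3 ^ l"
      using that by (simp only: power_add[symmetric] le_add_diff_inverse2)
    then have "k div 3 ^ l < 3 ^ (h - l)" by (rule less_mult_imp_div_less)
    then show ?thesis using that by (simp add: tree_nodes_def)
  qed
  have E: "E (0, Suc i) (0, Suc j) \<longleftrightarrow> leaf_link (int i) (int j)" if ij: "i < 3 ^ h" "j < 3 ^ h" for i j
  proof
    assume "E (0, Suc i) (0, Suc j)"
    then obtain l where "\<bar>int (Suc (j div 3 ^ l)) - int (Suc (i div 3 ^ l))\<bar> = 3"
      unfolding E_def tree_ancestor_leaf_iff[OF ij(1)] tree_ancestor_leaf_iff[OF ij(2)]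
      by (auto simp: linked_def)
    then show "leaf_link (int i) (int j)"
      by (intro leaf_linkI[of _ l]) (simp add: zdiv_int abs_minus_commute)
  next
    assume "leaf_link (int i) (int j)"
    then obtain l where l: "\<bar>int (i div 3 ^ l) - int (j div 3 ^ l)\<bar> = 3"
      by (auto simp: leaf_link_def zdiv_int)
    \<comment> \<open>A link level above the height is impossible: both leaves would lie in block
      0.\<close>
    have "l \<le> h"
    proof (rule ccontr)
      assume "\<not> l \<le> h"
      then have "(3::nat) ^ h \<le> 3 ^ l" by (intro power_increasing) auto
      then have "i < 3 ^ l" "j < 3 ^ l" using ij by linarith+
      then have "i div 3 ^ l = 0" "j div 3 ^ l = 0" by simp_all
      then show False using l by simp
    qed
    then show "E (0, Suc i) (0, Suc j)"
      unfolding E_def tree_ancestor_leaf_iff[OF ij(1)] tree_ancestor_leaf_iff[OF ij(2)]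
      by (intro exI[of _ l] bexI[of _ "(l, Suc (i div 3 ^ l))"] bexI[of _ "(l, Suc (j div 3 ^ l))"])
        (use l ij in \<open>auto simp: linked_def node\<close>)
  qed
  have "leaf x \<in> tree_leaves h" "leaf y \<in> tree_leaves h"
    using verts_A3[of h] x y by (auto simp: A3_def)
  moreover have "edges (A3 h) = {{u, v} | u v. u \<in> tree_leaves h \<and> v \<in> tree_leaves h \<and> E u v}"
    by (simp add: A3_def E_def)
  ultimately have "{leaf x, leaf y} \<in> edges (A3 h) \<longleftrightarrow> E (leaf x) (leaf y) \<or> E (leaf y) (leaf x)"
    by (simp only: doubleton_mem_iff) simp
  also have "\<dots> \<longleftrightarrow> leaf_link x y"
    unfolding lf unfolding xm(1) yn(1) using E[OF xm(2) yn(2)] E[OF yn(2) xm(2)] leaf_link_sym[of "int m" "int n"] by simp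
  finally show ?thesis .
qed

section \<open>The linear lower bound for the component twin-width\<close>

lemma height_le_ctww:
  assumes h: "h \<ge> 3"
  shows "h \<le> 18 * ctww (A3 h) + 38"
proof -
  let ?V = "{0..<3 ^ h} :: int set" and ?Z = "{3 ^ (h - 1)..<2 * 3 ^ (h - 1)} :: int set"
  have h3: "(3::int) ^ h = 3 * 3 ^ (h - 1)" using h by (simp flip: power_Suc)
  have a3: "(3::nat) ^ (h - 1) = 3 * 3 ^ (h - 2)" using h by (simp flip: power_Suc add: Suc_diff_Suc)
  have ZV: "?Z \<subseteq> ?V" unfolding h3 by auto
  have fin: "finite (verts (A3 h))" and ne: "verts (A3 h) \<noteq> {}" by (auto simp: verts_A3)
  have cardZ: "card (leaf ` ?Z) = 3 ^ (h - 1)"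
  proof -
    have "card (leaf ` ?Z) = card ?Z" by (intro card_image inj_on_subset[OF inj_on_leaf ZV])
    then show ?thesis by (simp add: nat_power_eq)
  qed
  obtain \<P> where P: "partition_sequence (A3 h) \<P>"
    "\<And>i. i \<in> {1..card (verts (A3 h))} \<Longrightarrow> largest_component (red_graph (A3 h) (\<P> i)) \<le> ctww (A3 h)"
    using ex_partition_sequence_ctww[OF fin ne] by blast
  \<comment> \<open>The threshold is a third of the middle third, so a weight between
    \<open>a\<close> and \<open>2 * a\<close> is the balance required later;
    \<open>h \<ge> 3\<close> makes it exceed 1.\<close>
  have "\<exists>U\<subseteq>verts (A3 h). 3 ^ (h - 2) \<le> card (U \<inter> leaf ` ?Z) \<and> card (U \<inter> leaf ` ?Z) < 2 * 3 ^ (h - 2) \<and>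
    card ((\<lambda>u. {w \<in> verts (A3 h) - U. {u, w} \<in> edges (A3 h)}) ` U) \<le> ctww (A3 h) + 1"
  proof (rule ex_balanced_cut[OF fin P])
    show "leaf ` ?Z \<subseteq> verts (A3 h)" unfolding verts_A3 using ZV by (rule image_mono)
    show "1 < (3::nat) ^ (h - 2)" using h by (intro one_less_power) auto
    show "(3::nat) ^ (h - 2) \<le> card (leaf ` ?Z)" unfolding cardZ by (intro power_increasing) auto
  qed
  then obtain U where UV: "U \<subseteq> verts (A3 h)" and U: "3 ^ (h - 2) \<le> card (U \<inter> leaf ` ?Z)" "card (U \<inter> leaf ` ?Z) < 2 * 3 ^ (h - 2)"
    and nb: "card ((\<lambda>u. {w \<in> verts (A3 h) - U. {u, w} \<in> edges (A3 h)}) ` U) \<le> ctww (A3 h) + 1"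
    by (elim exE conjE)
  define U' where "U' = {x \<in> ?V. leaf x \<in> U}"
  define W' where "W' = ?V - U'"
  have "U \<subseteq> leaf ` ?V" using UV unfolding verts_A3 .
  then have "U \<inter> leaf ` ?Z = leaf ` (U' \<inter> ?Z)" using ZV by (auto simp: U'_def)
  then have "card (U \<inter> leaf ` ?Z) = card (U' \<inter> ?Z)"
    using inj_on_subset[OF inj_on_subset[OF inj_on_leaf ZV], of "U' \<inter> ?Z"] by (simp add: card_image)
  then have bal: "3 ^ (h - 1) \<le> 3 * card (U' \<inter> ?Z)" "3 * card (U' \<inter> ?Z) \<le> 2 * 3 ^ (h - 1)"
    using U unfolding a3 by auto
  define N where "N u = {w \<in> verts (A3 h) - U. {u, w} \<in> edges (A3 h)}" for u
  have "link_nbrs W' x = {y \<in> ?V. leaf y \<in> N (leaf x)}" if "x \<in> U'" for x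
  proof -
    have "leaf y \<in> verts (A3 h)" if "y \<in> ?V" for y using that by (simp only: verts_A3 imageI)
    moreover have "x \<in> ?V" using that by (simp add: U'_def)
    ultimately show ?thesis using edge_A3_iff[OF \<open>x \<in> ?V\<close>]
      unfolding link_nbrs_def W'_def N_def U'_def by blast
  qed
  \<comment> \<open>Types of positions are images of neighbourhoods in \<open>A3 h\<close>, so there
    are no more of them than the cut provides.\<close>
  then have "link_nbrs W' ` U' \<subseteq> (\<lambda>M. {y \<in> ?V. leaf y \<in> M}) ` N ` U"
    by (auto simp: U'_def)
  moreover have finU: "finite U" using UV fin finite_subset by blast
  ultimately have "card (link_nbrs W' ` U') \<le> card ((\<lambda>M. {y \<in> ?V. leaf y \<in> M}) ` N ` U)"
    by (intro card_mono) auto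
  also have "\<dots> \<le> card (N ` U)" using finU by (intro card_image_le) auto
  also have "\<dots> \<le> ctww (A3 h) + 1" using nb by (simp add: N_def)
  finally have "card (link_nbrs W' ` U') \<le> ctww (A3 h) + 1" .
  moreover have "h \<le> 18 * card (link_nbrs W' ` U') + 20"
    by (rule height_le_card_link_nbrs) (use h bal in \<open>auto simp: W'_def U'_def\<close>)
  \<comment> \<open>With at most \<open>ctww (A3 h) + 1\<close> types, \<open>18 + 20\<close> gives
    the constant 38.\<close>
  ultimately show ?thesis by linarith
qed

theorem theorem17:
  "\<exists>c::real. c > 0 \<and>
     (\<exists>h0::nat. \<forall>h\<ge>h0. real (ctww (A3 h)) \<ge> c * real h / ln (real h))"
\<comment> \<open>From \<open>h \<ge> 76\<close>, twice 38, the additive constant is at most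
  \<open>h / 2\<close>, so the linear bound gives \<open>h / 36\<close>. Division by
  \<open>ln h \<ge> 1\<close> only weakens it.\<close>
proof (intro exI[of _ "1/36"] conjI exI[of _ 76] allI impI)
  fix h :: nat assume h: "76 \<le> h"
  have "1 \<le> ln (real h)"
  proof -
    have "exp 1 \<le> real h" using exp_le h by linarith
    then show ?thesis using h by (simp add: ln_ge_iff)
  qed
  then have "real h * 1 \<le> real h * ln (real h)" by (intro mult_left_mono) auto
  with \<open>1 \<le> ln (real h)\<close> have "1 / 36 * real h / ln (real h) \<le> 1 / 36 * real h"
    using h by (simp add: divide_le_eq)
  also have "\<dots> \<le> real (ctww (A3 h))"
  proof -
    have "real h \<le> real (18 * ctww (A3 h) + 38)" using height_le_ctww[of h] h by (simp only: of_nat_le_iff)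
    then show ?thesis using h by simp
  qed
  finally show "1 / 36 * real h / ln (real h) \<le> real (ctww (A3 h))" .
qed simp

end
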